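(* There exists a periodic branch group that is not contained in $\mathcal{MF}$, i.e. a branch group in which every element has finite order and which possesses a maximal subgroup of infinite index.
   Context: $\mathcal{MF}$ is the class of groups all of whose maximal subgroups have finite index. For a finite non-empty set $X$, $X^\ast$ is the rooted tree of finite words over $X$ (root the empty word; $u$ is joined to $ux$ for $x\in X$), and $\mathrm{Aut}(X^\ast)$ is its group of automorphisms. A subgroup $G\le\mathrm{Aut}(X^\ast)$ is spherically transitive if it acts transitively on the set $X^n$ of words of length $n$ for every $n$. The rigid vertex stabiliser $\mathrm{rist}_G(v)$ of a vertex $v$ is the subgroup of all elements of $G$ that fix every vertex outside the subtree $vX^\ast$; $\mathrm{Rist}_G(n)$ is the product of all $\mathrm{rist}_G(v)$ with $v\in X^n$. A spherically transitive group $G$ is a branch group if $\mathrm{Rist}_G(n)$ has finite index in $G$ for every $n\in\mathbb{N}$. *)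

theory Defs
  imports "HOL-Algebra.Bij" "HOL-Algebra.Generated_Groups" "HOL-Library.Sublist"
begin

section \<open>Maximal subgroups, the class MF, periodic groups\<close>

definition maximal_subgroup :: "'a set \<Rightarrow> ('a, 'b) monoid_scheme \<Rightarrow> bool" where
  "maximal_subgroup M G \<longleftrightarrow>
     subgroup M G \<and> M \<noteq> carrier G \<and>
     (\<forall>H. subgroup H G \<and> M \<subseteq> H \<longrightarrow> H = M \<or> H = carrier G)"

text \<open>Stated through the set of cosets, because \<^const>\<open>card\<close> of an infinite set is 0.\<close>

definition finite_index :: "'a set \<Rightarrow> ('a, 'b) monoid_scheme \<Rightarrow> bool" where
  "finite_index H G \<longleftrightarrow> finite (rcosets\<^bsub>G\<^esub> H)"

definition in_MF :: "('a, 'b) monoid_scheme \<Rightarrow> bool" where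
  "in_MF G \<longleftrightarrow> group G \<and> (\<forall>M. maximal_subgroup M G \<longrightarrow> finite_index M G)"

definition periodic_group :: "('a, 'b) monoid_scheme \<Rightarrow> bool" where
  "periodic_group G \<longleftrightarrow>
     group G \<and> (\<forall>g\<in>carrier G. \<exists>n::nat. n > 0 \<and> g [^]\<^bsub>G\<^esub> n = \<one>\<^bsub>G\<^esub>)"


section \<open>The rooted tree of words and its automorphism group\<close>

text \<open>The vertex set is \<^term>\<open>lists X\<close>, the root is the empty word.\<close>

definition level :: "'a set \<Rightarrow> nat \<Rightarrow> 'a list set" where
  "level X n = {w \<in> lists X. length w = n}"

definition tree_adj :: "'a set \<Rightarrow> 'a list \<Rightarrow> 'a list \<Rightarrow> bool" where
  "tree_adj X u v \<longleftrightarrow>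
     u \<in> lists X \<and> v \<in> lists X \<and> (\<exists>x\<in>X. v = u @ [x] \<or> u = v @ [x])"

definition tree_auts :: "'a set \<Rightarrow> ('a list \<Rightarrow> 'a list) set" where
  "tree_auts X =
     {f \<in> Bij (lists X). f [] = [] \<and>
        (\<forall>u\<in>lists X. \<forall>v\<in>lists X. tree_adj X (f u) (f v) \<longleftrightarrow> tree_adj X u v)}"

definition Aut_tree :: "'a set \<Rightarrow> ('a list \<Rightarrow> 'a list) monoid" where
  "Aut_tree X = BijGroup (lists X) \<lparr>carrier := tree_auts X\<rparr>"

lemma subgroup_tree_auts: "subgroup (tree_auts X) (BijGroup (lists X))"
proof -
  interpret group "BijGroup (lists X)" by (rule group_BijGroup)
  show ?thesis
  proof (rule subgroupI)
    show "tree_auts X \<subseteq> carrier (BijGroup (lists X))"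
      by (auto simp: tree_auts_def BijGroup_def)
    have "(\<lambda>x\<in>lists X. x) \<in> tree_auts X"
      by (auto simp: tree_auts_def id_Bij)
    then show "tree_auts X \<noteq> {}" by blast
  next
    fix f assume f: "f \<in> tree_auts X"
    then have fB: "f \<in> Bij (lists X)" by (simp add: tree_auts_def)
    then have bij: "bij_betw f (lists X) (lists X)" by (simp add: Bij_def)
    let ?g = "inv_into (lists X) f"
    have inv: "inv\<^bsub>BijGroup (lists X)\<^esub> f = (\<lambda>x\<in>lists X. ?g x)"
      using fB by (rule inv_BijGroup)
    have mem: "?g u \<in> lists X" and fg: "f (?g u) = u" if "u \<in> lists X" for u
      using bij that by (auto simp: Bij_inv_into_mem[OF fB] bij_betw_inv_into_right)
    have root: "?g [] = []"
      using bij_betw_inv_into_left[OF bij, of "[]"] f by (simp add: tree_auts_def)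
    have adj: "tree_adj X (?g u) (?g v) \<longleftrightarrow> tree_adj X u v"
      if "u \<in> lists X" "v \<in> lists X" for u v
    proof -
      have "tree_adj X (f (?g u)) (f (?g v)) \<longleftrightarrow> tree_adj X (?g u) (?g v)"
        using f mem[OF that(1)] mem[OF that(2)] by (simp add: tree_auts_def)
      then show ?thesis by (simp only: fg[OF that(1)] fg[OF that(2)])
    qed
    have "(\<lambda>x\<in>lists X. ?g x) \<in> Bij (lists X)"
      using fB by (rule restrict_inv_into_Bij)
    with root adj show "inv\<^bsub>BijGroup (lists X)\<^esub> f \<in> tree_auts X"
      unfolding inv tree_auts_def by (simp add: restrict_def)
  next
    fix f g assume f: "f \<in> tree_auts X" and g: "g \<in> tree_auts X"
    then have fB: "f \<in> Bij (lists X)" and gB: "g \<in> Bij (lists X)"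
      by (auto simp: tree_auts_def)
    have mem: "g u \<in> lists X" if "u \<in> lists X" for u
      using Bij_imp_funcset[OF gB] that by blast
    have mult: "f \<otimes>\<^bsub>BijGroup (lists X)\<^esub> g = compose (lists X) f g"
      using fB gB by (simp add: BijGroup_def)
    have "compose (lists X) f g \<in> Bij (lists X)"
      using fB gB by (rule compose_Bij)
    moreover have "compose (lists X) f g [] = []"
      using f g by (simp add: tree_auts_def compose_def)
    moreover have "tree_adj X (compose (lists X) f g u) (compose (lists X) f g v) \<longleftrightarrow> tree_adj X u v"
      if "u \<in> lists X" "v \<in> lists X" for u v
    proof -
      have "tree_adj X (f (g u)) (f (g v)) \<longleftrightarrow> tree_adj X (g u) (g v)"
        using f mem[OF that(1)] mem[OF that(2)] by (simp add: tree_auts_def)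
      moreover have "tree_adj X (g u) (g v) \<longleftrightarrow> tree_adj X u v"
        using g that by (simp add: tree_auts_def)
      ultimately show ?thesis
        by (simp only: compose_eq[OF that(1)] compose_eq[OF that(2)])
    qed
    ultimately show "f \<otimes>\<^bsub>BijGroup (lists X)\<^esub> g \<in> tree_auts X"
      unfolding mult tree_auts_def by blast
  qed
qed

lemma group_Aut_tree: "group (Aut_tree X)"
  unfolding Aut_tree_def
  by (rule subgroup.subgroup_is_group[OF subgroup_tree_auts group_BijGroup])


section \<open>Branch groups\<close>

text \<open>
  In what follows \<open>G\<close> is the underlying set of a subgroup of \<^term>\<open>Aut_tree X\<close>;
  \<open>tree_group X G\<close> is this subgroup as a group in its own right.
\<close>

definition tree_group ::
    "'a set \<Rightarrow> ('a list \<Rightarrow> 'a list) set \<Rightarrow> ('a list \<Rightarrow> 'a list) monoid" where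
  "tree_group X G = Aut_tree X \<lparr>carrier := G\<rparr>"

definition spherically_transitive :: "'a set \<Rightarrow> ('a list \<Rightarrow> 'a list) set \<Rightarrow> bool" where
  "spherically_transitive X G \<longleftrightarrow>
     (\<forall>n. \<forall>u\<in>level X n. \<forall>v\<in>level X n. \<exists>g\<in>G. g u = v)"

definition rist ::
    "'a set \<Rightarrow> ('a list \<Rightarrow> 'a list) set \<Rightarrow> 'a list \<Rightarrow> ('a list \<Rightarrow> 'a list) set" where
  "rist X G v = {g \<in> G. \<forall>u\<in>lists X. \<not> prefix v u \<longrightarrow> g u = u}"

text \<open>
  The rigid stabilisers of distinct vertices of one level commute elementwise (their
  supports are disjoint), so their product is the subgroup they generate.
\<close>

definition Rist ::
    "'a set \<Rightarrow> ('a list \<Rightarrow> 'a list) set \<Rightarrow> nat \<Rightarrow> ('a list \<Rightarrow> 'a list) set" where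
  "Rist X G n = generate (tree_group X G) (\<Union>v\<in>level X n. rist X G v)"

definition branch_group :: "'a set \<Rightarrow> ('a list \<Rightarrow> 'a list) set \<Rightarrow> bool" where
  "branch_group X G \<longleftrightarrow>
     finite X \<and> X \<noteq> {} \<and> subgroup G (Aut_tree X) \<and> spherically_transitive X G \<and>
     (\<forall>n. finite_index (Rist X G n) (tree_group X G))"

lemma branch_group_imp_group: "branch_group X G \<Longrightarrow> group (tree_group X G)"
  unfolding branch_group_def tree_group_def
  by (blast intro: subgroup.subgroup_is_group group_Aut_tree)

end

theory Submission
  imports Defs "HOL-Algebra.Sym_Groups" "HOL-Algebra.Multiplicative_Group"
begin

text \<open>
  The example is a locally finite group.  Let \<open>X = {0..5}\<close> and let \<open>Q\<close> be the alternating group on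
  the letters \<open>1..5\<close>.  For \<open>q \<in> Q\<close> let \<open>\<beta>\<^sub>q\<close> be the tree automorphism that applies \<open>q\<close> to the first
  letter of a word that is different from \<open>0\<close>.  As \<open>q\<close> fixes \<open>0\<close>, the map \<open>q \<mapsto> \<beta>\<^sub>q\<close> is a
  homomorphism.  Let \<open>G\<close> consist of the automorphisms that, below some level, act in each subtree as
  one of the \<open>\<beta>\<^sub>q\<close>, and let \<open>F \<le> G\<close> be the subgroup of finitary automorphisms, those that act
  trivially in each subtree below some level.

  \<^item> For a fixed level there are only finitely many such automorphisms and they form a group, because
    the \<open>\<beta>\<^sub>q\<close> do.  The groups so obtained increase with the level, so \<open>G\<close> is a union of a chain of
    finite groups, hence periodic.
  \<^item> Restricting an element of \<open>G\<close> that fixes a level to one of the subtrees at that level gives an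
    element of \<open>G\<close> again.  So the rigid level stabiliser is the whole level stabiliser, and has finite
    index.  Already \<open>F\<close> is transitive on every level.  So \<open>G\<close> is a branch group.
  \<^item> \<open>\<beta>\<^sub>q\<close> differs from its copy at the vertex \<open>0\<^sup>n\<close> by a finitary factor.  With conjugation by
    elements of \<open>F\<close> it follows that a subgroup above \<open>F\<close> contains \<open>\<beta>\<^sub>q\<close> as soon as it contains the
    copy of \<open>\<beta>\<^sub>q\<close> at some vertex, that it then contains the copies at all vertices, and that \<open>G\<close> is
    generated by \<open>F\<close> and the finitely many \<open>\<beta>\<^sub>q\<close>.  As \<open>F\<close> is proper, Zorn's lemma gives a maximal
    subgroup \<open>M\<close> of \<open>G\<close> above \<open>F\<close>.
  \<^item> Suppose that \<open>M\<close> has finite index, let \<open>p, q \<in> Q\<close>, and take infinitely many pairwise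
    incomparable vertices.  By the pigeonhole principle three of them, \<open>u, v, w\<close>, have copies of
    \<open>\<beta>\<^sub>p\<close> in one coset of \<open>M\<close> and copies of \<open>\<beta>\<^sub>q\<close> in one coset of \<open>M\<close>.  Then \<open>M\<close> contains
    \<open>\<beta>\<^sub>p\<close> at \<open>u\<close> times \<open>\<beta>\<^sub>p\<^sup>-\<^sup>1\<close> at \<open>v\<close>, and \<open>\<beta>\<^sub>q\<close> at \<open>u\<close> times \<open>\<beta>\<^sub>q\<^sup>-\<^sup>1\<close> at \<open>w\<close>.  The
    commutator of these two elements is the copy at \<open>u\<close> of \<open>\<beta>\<close> for the commutator of \<open>p\<close> and
    \<open>q\<close>, because copies at incomparable vertices commute.  So \<open>M\<close> contains all \<open>\<beta>\<close> of commutators,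
    and since \<open>Q\<close> is perfect, all \<open>\<beta>\<^sub>q\<close>; then \<open>M = G\<close>, which is absurd.

  These steps are \<open>periodic_eventually_directed\<close>, \<open>branch_group_eventually_directed\<close>,
  \<open>eventually_directed_generated\<close>, \<open>maximal_subgroup_above\<close> and \<open>finite_index_above_finitary\<close>.
\<close>

section \<open>Tree automorphisms preserve lengths and prefixes\<close>

lemma tree_autsD:
  assumes "g \<in> tree_auts X"
  shows "bij_betw g (lists X) (lists X)" "g \<in> extensional (lists X)" "g [] = []" "inj_on g (lists X)"
  using assms by (auto simp: tree_auts_def Bij_def bij_betw_def)

lemma tree_auts_mem: "g \<in> tree_auts X \<Longrightarrow> w \<in> lists X \<Longrightarrow> g w \<in> lists X"
  using tree_autsD(1) bij_betwE by blast

lemma tree_auts_adj: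
  assumes "g \<in> tree_auts X" "tree_adj X u v"
  shows "tree_adj X (g u) (g v)"
proof -
  have "u \<in> lists X" "v \<in> lists X" using assms(2) by (auto simp: tree_adj_def)
  then show ?thesis using assms unfolding tree_auts_def by blast
qed

text \<open>
  Adjacency alone does not distinguish children from parents.  By induction, \<open>g\<close> maps the parent
  of a vertex to the parent of its image, so by injectivity no child can be mapped to a parent.
\<close>

lemma tree_auts_snoc:
  assumes g: "g \<in> tree_auts X" and "w \<in> lists X" "x \<in> X"
  shows "\<exists>y\<in>X. g (w @ [x]) = g w @ [y]"
  using assms(2,3)
proof (induction w arbitrary: x rule: rev_induct)
  case Nil
  have "tree_adj X [] [x]" using Nil by (auto simp: tree_adj_def)
  then have "tree_adj X (g []) (g [x])"
    by (rule tree_auts_adj[OF g])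
  then show ?case
    using tree_autsD(3)[OF g] by (auto simp: tree_adj_def)
next
  case (snoc a w)
  then have w: "w \<in> lists X" "a \<in> X" "w @ [a] \<in> lists X" by auto
  have "tree_adj X (w @ [a]) ((w @ [a]) @ [x])"
    using snoc.prems by (auto simp: tree_adj_def)
  then have "tree_adj X (g (w @ [a])) (g ((w @ [a]) @ [x]))"
    by (rule tree_auts_adj[OF g])
  moreover have "g (w @ [a]) \<noteq> g ((w @ [a]) @ [x]) @ [y]" for y
  proof
    assume "g (w @ [a]) = g ((w @ [a]) @ [x]) @ [y]"
    with snoc.IH[OF w(1,2)] have "g ((w @ [a]) @ [x]) = g w" by auto
    moreover have "(w @ [a]) @ [x] \<in> lists X" using snoc.prems by auto
    ultimately have "(w @ [a]) @ [x] = w"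
      using tree_autsD(4)[OF g] w(1) by (blast dest: inj_onD)
    then show False by simp
  qed
  ultimately show ?case by (auto simp: tree_adj_def)
qed

lemma tree_auts_append:
  assumes g: "g \<in> tree_auts X" and "u \<in> lists X" "w \<in> lists X"
  shows "\<exists>z. length z = length w \<and> g (u @ w) = g u @ z"
  using assms(3)
proof (induction w rule: rev_induct)
  case (snoc x w)
  then obtain z where z: "length z = length w" "g (u @ w) = g u @ z" by auto
  have "u @ w \<in> lists X" "x \<in> X" using assms(2) snoc.prems by auto
  then obtain y where "g ((u @ w) @ [x]) = g (u @ w) @ [y]"
    using tree_auts_snoc[OF g] by blast
  with z have "g (u @ w @ [x]) = g u @ (z @ [y])" by simp
  with z show ?case by (metis length_append_singleton)
qed simp

lemma tree_auts_length: "g \<in> tree_auts X \<Longrightarrow> w \<in> lists X \<Longrightarrow> length (g w) = length w"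
  using tree_auts_append[of g X "[]" w] tree_autsD(3)[of g X] by auto

lemma tree_auts_take:
  assumes "g \<in> tree_auts X" "w \<in> lists X"
  shows "take n (g w) = g (take n w)"
proof -
  have "take n w \<in> lists X" "drop n w \<in> lists X"
    using assms(2) by (auto dest: in_set_takeD in_set_dropD)
  then obtain z where z: "g w = g (take n w) @ z"
    using tree_auts_append[OF assms(1), of "take n w" "drop n w"] by auto
  have l: "length (g (take n w)) = min (length w) n" "length (g w) = length w"
    using tree_auts_length[OF assms(1)] \<open>take n w \<in> lists X\<close> assms(2) by auto
  show ?thesis
  proof (cases "n \<le> length w")
    case True
    with l(1) have "length (g (take n w)) = n" by simp
    then show ?thesis using z by (metis append_eq_conv_conj)
  next
    case False
    with l show ?thesis by simp
  qed
qed

lemma tree_auts_level: "g \<in> tree_auts X \<Longrightarrow> v \<in> level X n \<Longrightarrow> g v \<in> level X n"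
  using tree_auts_mem[of g X v] tree_auts_length[of g X v] by (simp add: level_def)

lemma finite_level: "finite X \<Longrightarrow> finite (level X n)"
  by (rule finite_subset[OF _ finite_lists_length_eq[of X n]]) (auto simp: level_def)

lemma level_splitE:
  assumes "w \<in> lists X" "n \<le> length w"
  obtains v u where "w = v @ u" "v \<in> level X n" "u \<in> lists X"
proof (rule that)
  show "w = take n w @ drop n w" by simp
  show "take n w \<in> level X n" "drop n w \<in> lists X"
    using assms by (auto simp: level_def dest: in_set_takeD in_set_dropD)
qed

text \<open>On a finite alphabet an injective map that preserves lengths and prefixes permutes each
  level, so bijectivity need not be checked separately.\<close>

lemma tree_autsI:
  assumes fin: "finite X"
    and mem: "\<And>w. w \<in> lists X \<Longrightarrow> f w \<in> lists X"
    and len: "\<And>w. w \<in> lists X \<Longrightarrow> length (f w) = length w"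
    and pre: "\<And>w n. w \<in> lists X \<Longrightarrow> take n (f w) = f (take n w)"
    and inj: "inj_on f (lists X)"
  shows "restrict f (lists X) \<in> tree_auts X"
proof -
  have "w \<in> f ` lists X" if w: "w \<in> lists X" for w
  proof -
    have "f ` level X (length w) \<subseteq> level X (length w)"
    proof (rule image_subsetI)
      fix v assume "v \<in> level X (length w)"
      then show "f v \<in> level X (length w)"
        using mem[of v] len[of v] by (simp add: level_def)
    qed
    moreover have "inj_on f (level X (length w))"
      using inj by (rule inj_on_subset) (auto simp: level_def)
    ultimately have "f ` level X (length w) = level X (length w)"
      using finite_level[OF fin] by (simp add: card_image card_subset_eq)
    then show ?thesis using w unfolding level_def by blast
  qed
  then have bij: "bij_betw f (lists X) (lists X)"
    using inj by (simp add: bij_betw_def set_eq_subset image_subset_iff mem subset_eq)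
  have child: "(\<exists>x\<in>X. f v = f u @ [x]) \<longleftrightarrow> (\<exists>x\<in>X. v = u @ [x])"
    if u: "u \<in> lists X" and v: "v \<in> lists X" for u v
  proof
    assume "\<exists>x\<in>X. v = u @ [x]"
    then obtain x where x: "v = u @ [x]" by blast
    have "f v = take (length u) (f v) @ drop (length u) (f v)" by simp
    also have "take (length u) (f v) = f u" using pre[OF v, of "length u"] x by simp
    finally have *: "f v = f u @ drop (length u) (f v)" .
    have "length (drop (length u) (f v)) = 1" using len[OF v] x by simp
    then obtain y where y: "drop (length u) (f v) = [y]" 
      by (metis One_nat_def length_0_conv length_Suc_conv)
    with * have "f v = f u @ [y]" by simp
    then show "\<exists>x\<in>X. f v = f u @ [x]" using mem[OF v] by auto
  next
    assume "\<exists>x\<in>X. f v = f u @ [x]"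
    then obtain x where x: "f v = f u @ [x]" by blast
    have l: "length v = Suc (length u)" using len[OF u] len[OF v] x by simp
    have "f (take (length u) v) = take (length u) (f v)" using pre[OF v] by simp
    then have "f (take (length u) v) = f u" using x len[OF u] by simp
    moreover have "take (length u) v \<in> lists X" using v by (auto dest: in_set_takeD)
    ultimately have t: "take (length u) v = u" using inj u by (auto dest: inj_onD)
    have "length (drop (length u) v) = 1" using l by simp
    then obtain y where "drop (length u) v = [y]"
      by (metis One_nat_def length_0_conv length_Suc_conv)
    then have "v = u @ [y]" using t by (metis append_take_drop_id)
    then show "\<exists>x\<in>X. v = u @ [x]" using v by auto
  qed
  have "f [] = []" using len[of "[]"] by simp
  moreover have "tree_adj X (f u) (f v) \<longleftrightarrow> tree_adj X u v" if "u \<in> lists X" "v \<in> lists X" for u v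
    using child[OF that] child[OF that(2,1)] mem[OF that(1)] mem[OF that(2)] that
    unfolding tree_adj_def by blast
  ultimately show ?thesis
    using bij unfolding tree_auts_def Bij_def by (simp cong: bij_betw_cong)
qed

section \<open>Computing in the automorphism group\<close>

lemma tree_auts_compose: "f \<in> tree_auts X \<Longrightarrow> g \<in> tree_auts X \<Longrightarrow> f \<otimes>\<^bsub>Aut_tree X\<^esub> g = compose (lists X) f g"
  by (simp add: Aut_tree_def BijGroup_def tree_auts_def)

lemma carrier_Aut_tree [simp]: "carrier (Aut_tree X) = tree_auts X"
  by (simp add: Aut_tree_def)

lemma one_Aut_tree: "\<one>\<^bsub>Aut_tree X\<^esub> = (\<lambda>x\<in>lists X. x)"
  by (simp add: Aut_tree_def BijGroup_def)

lemma tree_auts_mult: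
  "f \<in> tree_auts X \<Longrightarrow> g \<in> tree_auts X \<Longrightarrow> w \<in> lists X \<Longrightarrow> (f \<otimes>\<^bsub>Aut_tree X\<^esub> g) w = f (g w)"
  by (simp add: tree_auts_compose compose_def)

lemma tree_auts_eqI:
  assumes "f \<in> tree_auts X" "g \<in> tree_auts X" "\<And>w. w \<in> lists X \<Longrightarrow> f w = g w"
  shows "f = g"
  using extensionalityI[OF tree_autsD(2)[OF assms(1)] tree_autsD(2)[OF assms(2)]] assms(3) by blast

lemma tree_auts_inv:
  assumes "f \<in> tree_auts X" "w \<in> lists X"
  shows "(inv\<^bsub>Aut_tree X\<^esub> f) (f w) = w" "f ((inv\<^bsub>Aut_tree X\<^esub> f) w) = w"
proof -
  interpret group "Aut_tree X" by (rule group_Aut_tree)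
  have i: "inv\<^bsub>Aut_tree X\<^esub> f \<in> tree_auts X" using assms inv_closed by simp
  have "(inv\<^bsub>Aut_tree X\<^esub> f \<otimes>\<^bsub>Aut_tree X\<^esub> f) w = w" "(f \<otimes>\<^bsub>Aut_tree X\<^esub> inv\<^bsub>Aut_tree X\<^esub> f) w = w"
    using l_inv r_inv assms by (auto simp: one_Aut_tree)
  then show "(inv\<^bsub>Aut_tree X\<^esub> f) (f w) = w" "f ((inv\<^bsub>Aut_tree X\<^esub> f) w) = w"
    using tree_auts_mult i assms by metis+
qed

text \<open>Subgroups of a subgroup of \<^term>\<open>Aut_tree X\<close> are subgroups of \<^term>\<open>Aut_tree X\<close>; this is used
  to compute in one group only.\<close>

lemma subgroup_tree_group_iff:
  assumes "subgroup G (Aut_tree X)"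
  shows "subgroup H (tree_group X G) \<longleftrightarrow> subgroup H (Aut_tree X) \<and> H \<subseteq> G"
proof -
  interpret group "Aut_tree X" by (rule group_Aut_tree)
  show ?thesis
    unfolding tree_group_def
    using incl_subgroup[OF assms] subgroup_incl[OF _ assms] subgroup.subset by fastforce
qed

text \<open>
  If \<open>\<phi>\<close> separates elements at least as well as the cosets of \<open>H\<close> do, then there are no more
  cosets than values of \<open>\<phi>\<close>.
\<close>

lemma finite_indexI:
  assumes "group G" "subgroup H G" "finite (\<phi> ` carrier G)"
    and eq: "\<And>g h. \<lbrakk>g \<in> carrier G; h \<in> carrier G; \<phi> g = \<phi> h\<rbrakk> \<Longrightarrow> g \<otimes>\<^bsub>G\<^esub> inv\<^bsub>G\<^esub> h \<in> H"
  shows "finite_index H G"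
proof -
  interpret group G by fact
  have coset: "H #>\<^bsub>G\<^esub> h = H #>\<^bsub>G\<^esub> g" if "g \<in> carrier G" "h \<in> carrier G" "\<phi> g = \<phi> h" for g h
    using that eq[OF that] repr_independence[OF _ that(2) assms(2)]
      subgroup.rcos_module[OF assms(2,1) that(2,1)] by blast
  have "H #>\<^bsub>G\<^esub> g = H #>\<^bsub>G\<^esub> inv_into (carrier G) \<phi> (\<phi> g)" if "g \<in> carrier G" for g
    using that by (intro coset) (auto intro: inv_into_into f_inv_into_f)
  then have "rcosets\<^bsub>G\<^esub> H \<subseteq> (\<lambda>y. H #>\<^bsub>G\<^esub> inv_into (carrier G) \<phi> y) ` \<phi> ` carrier G"
    unfolding RCOSETS_def by blast
  then show ?thesis
    unfolding finite_index_def by (rule finite_subset) (intro finite_imageI assms(3))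
qed

section \<open>Directed automorphisms and the groups built from them\<close>

text \<open>
  The automorphism \<open>\<beta>\<^sub>q\<close>.  It is applied only to permutations \<open>q\<close> that fix \<open>0\<close>; its sections
  along the ray \<open>0\<^sup>\<infinity>\<close> are all equal to itself.
\<close>

fun directed :: "(nat \<Rightarrow> nat) \<Rightarrow> nat list \<Rightarrow> nat list" where
  "directed q [] = []"
| "directed q (x # w) = (if x = 0 then 0 # directed q w else q x # w)"

lemma length_directed [simp]: "length (directed q w) = length w"
  by (induction w) auto

lemma directed_append:
  "directed q (u @ w) = directed q u @ (if set u \<subseteq> {0} then directed q w else w)"
  by (induction u) auto

lemma take_directed: "take n (directed q w) = directed q (take n w)"
proof -
  have "take n (directed q (take n w @ drop n w)) = directed q (take n w)"
    unfolding directed_append[of q "take n w"] by (cases "n \<le> length w") auto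
  then show ?thesis by simp
qed

lemma directed_id [simp]: "directed id w = w"
  by (induction w) auto

lemma directed_comp:
  assumes "r permutes X - {0}"
  shows "directed (q \<circ> r) w = directed q (directed r w)"
proof -
  have "r 0 = 0" using permutes_not_in[OF assms, of 0] by simp
  then have "r x = 0 \<longleftrightarrow> x = 0" for x
    using permutes_inj[OF assms] by (metis injD)
  then show ?thesis by (induction w) auto
qed

lemma directed_mem:
  assumes "q permutes X - {0}" "0 \<in> X" "w \<in> lists X"
  shows "directed q w \<in> lists X"
  using assms(3)
proof (induction w)
  case (Cons x w)
  then show ?case
    using permutes_in_image[OF assms(1), of x] assms(2) by auto
qed simp

text \<open>
  With \<open>P = {id}\<close> these are the automorphisms that are finitary of depth at most \<open>n\<close>, so that
  \<open>eventually_directed X {id}\<close> is the group of all finitary automorphisms.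
\<close>

definition directed_beyond :: "nat set \<Rightarrow> (nat \<Rightarrow> nat) set \<Rightarrow> nat \<Rightarrow> (nat list \<Rightarrow> nat list) set" where
  "directed_beyond X P n =
     {g \<in> tree_auts X. \<forall>v\<in>level X n. \<exists>q\<in>P. \<forall>u\<in>lists X. g (v @ u) = g v @ directed q u}"

definition eventually_directed :: "nat set \<Rightarrow> (nat \<Rightarrow> nat) set \<Rightarrow> (nat list \<Rightarrow> nat list) set" where
  "eventually_directed X P = (\<Union>n. directed_beyond X P n)"

lemma directed_beyondD: "g \<in> directed_beyond X P n \<Longrightarrow> g \<in> tree_auts X"
  by (simp add: directed_beyond_def)

lemma directed_beyondE:
  assumes "g \<in> directed_beyond X P n" "v \<in> level X n"
  obtains q where "q \<in> P" "\<And>u. u \<in> lists X \<Longrightarrow> g (v @ u) = g v @ directed q u"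
  using assms unfolding directed_beyond_def by blast

lemma level_lists: "v \<in> level X n \<Longrightarrow> v \<in> lists X"
  by (simp add: level_def)

locale letter_perms =
  fixes X :: "nat set" and P :: "(nat \<Rightarrow> nat) set"
  assumes finite_letters: "finite X"
    and zero_letter: "0 \<in> X"
    and id_mem: "id \<in> P"
    and comp_mem: "p \<in> P \<Longrightarrow> q \<in> P \<Longrightarrow> p \<circ> q \<in> P"
    and inv_mem: "p \<in> P \<Longrightarrow> inv' p \<in> P"
    and permutes: "p \<in> P \<Longrightarrow> p permutes X - {0}"
begin


lemma directed_lists: "q \<in> P \<Longrightarrow> w \<in> lists X \<Longrightarrow> directed q w \<in> lists X"
  by (rule directed_mem[OF permutes zero_letter])

lemma directed_inv:
  assumes "q \<in> P"
  shows "directed q (directed (inv' q) w) = w"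
  using directed_comp[OF permutes[OF inv_mem[OF assms]], of q w]
    permutes_inv_o(1)[OF permutes[OF assms]] by simp

text \<open>
  One level further down, the section of \<open>\<beta>\<^sub>q\<close> at the letter \<open>0\<close> is \<open>\<beta>\<^sub>q\<close> and at all other letters
  it is trivial.  A directed automorphism that acts with \<open>q\<close> only next to the ray, and not on it, would
  have a rooted permutation among its sections, and the inclusion would fail.
\<close>

lemma directed_beyond_Suc: "directed_beyond X P n \<subseteq> directed_beyond X P (Suc n)"
proof
  fix g assume g: "g \<in> directed_beyond X P n"
  have "\<exists>q\<in>P. \<forall>u\<in>lists X. g (v @ u) = g v @ directed q u" if v: "v \<in> level X (Suc n)" for v
  proof -
    obtain w x where v': "v = w @ [x]" "w \<in> level X n" "x \<in> X"
      using v unfolding level_def by (cases v rule: rev_cases) auto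
    obtain q where q: "q \<in> P" "\<And>u. u \<in> lists X \<Longrightarrow> g (w @ u) = g w @ directed q u"
      using directed_beyondE[OF g v'(2)] by blast
    define r where "r = (if x = 0 then q else id)"
    have "g (v @ u) = g v @ directed r u" if "u \<in> lists X" for u
      using q(2)[of "x # u"] q(2)[of "[x]"] that v' by (simp add: r_def)
    moreover have "r \<in> P" using q(1) id_mem by (simp add: r_def)
    ultimately show ?thesis by blast
  qed
  then show "g \<in> directed_beyond X P (Suc n)"
    using directed_beyondD[OF g] by (simp add: directed_beyond_def)
qed

lemma directed_beyond_mono: "n \<le> m \<Longrightarrow> directed_beyond X P n \<subseteq> directed_beyond X P m"
  by (rule lift_Suc_mono_le[of "directed_beyond X P", OF directed_beyond_Suc])

lemma subgroup_directed_beyond: "subgroup (directed_beyond X P n) (Aut_tree X)"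
proof -
  interpret group "Aut_tree X" by (rule group_Aut_tree)
  show ?thesis
  proof (rule subgroupI)
    show "directed_beyond X P n \<subseteq> carrier (Aut_tree X)"
      by (auto simp: directed_beyond_def)
    have "\<one>\<^bsub>Aut_tree X\<^esub> \<in> directed_beyond X P n"
      using one_closed id_mem unfolding directed_beyond_def one_Aut_tree carrier_Aut_tree
      by (auto simp: level_def intro!: bexI[of _ id])
    then show "directed_beyond X P n \<noteq> {}" by blast
  next
    fix g assume g: "g \<in> directed_beyond X P n"
    note gt = directed_beyondD[OF g]
    define h where "h = inv\<^bsub>Aut_tree X\<^esub> g"
    have ht: "h \<in> tree_auts X" using inv_closed gt by (simp add: h_def)
    note gh = tree_auts_inv[OF gt, folded h_def]
    have "\<exists>q\<in>P. \<forall>u\<in>lists X. h (v @ u) = h v @ directed q u" if v: "v \<in> level X n" for v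
    proof -
      have hv: "h v \<in> level X n" by (rule tree_auts_level[OF ht v])
      obtain q where q: "q \<in> P" "\<And>u. u \<in> lists X \<Longrightarrow> g (h v @ u) = g (h v) @ directed q u"
        using directed_beyondE[OF g hv] by blast
      have "h (v @ u) = h v @ directed (inv' q) u" if u: "u \<in> lists X" for u
      proof -
        let ?u = "directed (inv' q) u"
        have u': "?u \<in> lists X" by (rule directed_lists[OF inv_mem[OF q(1)] u])
        have "g (h v @ ?u) = v @ u"
          using q(2)[OF u'] directed_inv[OF q(1)] gh(2)[OF level_lists[OF v]] by simp
        moreover have "h v @ ?u \<in> lists X" using level_lists[OF hv] u' by simp
        ultimately show ?thesis using gh(1) by metis
      qed
      then show ?thesis using inv_mem[OF q(1)] by blast
    qed
    then show "inv\<^bsub>Aut_tree X\<^esub> g \<in> directed_beyond X P n"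
      using ht unfolding directed_beyond_def h_def by blast
  next
    fix f g assume f: "f \<in> directed_beyond X P n" and g: "g \<in> directed_beyond X P n"
    note ft = directed_beyondD[OF f] and gt = directed_beyondD[OF g]
    have "\<exists>q\<in>P. \<forall>u\<in>lists X. f (g (v @ u)) = f (g v) @ directed q u" if v: "v \<in> level X n" for v
    proof -
      obtain q where q: "q \<in> P" "\<And>u. u \<in> lists X \<Longrightarrow> g (v @ u) = g v @ directed q u"
        using directed_beyondE[OF g v] by blast
      obtain p where p: "p \<in> P" "\<And>u. u \<in> lists X \<Longrightarrow> f (g v @ u) = f (g v) @ directed p u"
        using directed_beyondE[OF f tree_auts_level[OF gt v]] by blast
      have "f (g (v @ u)) = f (g v) @ directed (p \<circ> q) u" if "u \<in> lists X" for u
        using q(2)[OF that] p(2)[OF directed_lists[OF q(1) that]]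
          directed_comp[OF permutes[OF q(1)]] by simp
      then show ?thesis using comp_mem[OF p(1) q(1)] by blast
    qed
    moreover have "f \<otimes>\<^bsub>Aut_tree X\<^esub> g \<in> tree_auts X" using m_closed ft gt by simp
    moreover have "(f \<otimes>\<^bsub>Aut_tree X\<^esub> g) (v @ u) = f (g (v @ u))"
      "(f \<otimes>\<^bsub>Aut_tree X\<^esub> g) v = f (g v)"
      if "v \<in> level X n" "u \<in> lists X" for v u
      using that by (auto intro!: tree_auts_mult[OF ft gt] simp: level_def)
    ultimately show "f \<otimes>\<^bsub>Aut_tree X\<^esub> g \<in> directed_beyond X P n"
      unfolding directed_beyond_def by simp
  qed
qed

lemma subgroup_eventually_directed: "subgroup (eventually_directed X P) (Aut_tree X)"
proof -
  interpret group "Aut_tree X" by (rule group_Aut_tree)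
  note sub = subgroup_directed_beyond
  show ?thesis
  proof (rule subgroupI)
    show "eventually_directed X P \<subseteq> carrier (Aut_tree X)"
      unfolding eventually_directed_def using subgroup.subset[OF sub] by blast
    show "eventually_directed X P \<noteq> {}"
      unfolding eventually_directed_def using subgroup.one_closed[OF sub] by blast
  next
    fix g assume "g \<in> eventually_directed X P"
    then show "inv\<^bsub>Aut_tree X\<^esub> g \<in> eventually_directed X P"
      unfolding eventually_directed_def using subgroup.m_inv_closed[OF sub] by blast
  next
    fix f g assume "f \<in> eventually_directed X P" "g \<in> eventually_directed X P"
    then obtain n m where "f \<in> directed_beyond X P n" "g \<in> directed_beyond X P m"
      unfolding eventually_directed_def by blast
    then have "f \<in> directed_beyond X P (max n m)" "g \<in> directed_beyond X P (max n m)"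
      using directed_beyond_mono[of n "max n m"] directed_beyond_mono[of m "max n m"] by auto
    then show "f \<otimes>\<^bsub>Aut_tree X\<^esub> g \<in> eventually_directed X P"
      unfolding eventually_directed_def using subgroup.m_closed[OF sub] by blast
  qed
qed

text \<open>
  Level \<open>n + 1\<close> determines the element: a permutation \<open>q\<close> can be read off from the action of \<open>\<beta>\<^sub>q\<close>
  on words of length one.
\<close>

lemma finite_directed_beyond: "finite (directed_beyond X P n)"
proof -
  define L where "L = level X (Suc n)"
  have "inj_on (\<lambda>g. restrict g L) (directed_beyond X P n)"
  proof (rule inj_onI)
    fix g h assume g: "g \<in> directed_beyond X P n" and h: "h \<in> directed_beyond X P n"
      and "restrict g L = restrict h L"
    then have L: "g w = h w" if "w \<in> L" for w using that by (metis restrict_apply')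
    note gt = directed_beyondD[OF g] and ht = directed_beyondD[OF h]
    have short: "g w = h w" if w: "w \<in> lists X" "length w \<le> Suc n" for w
    proof -
      let ?w = "w @ replicate (Suc n - length w) 0"
      have "?w \<in> L" using w zero_letter by (auto simp: L_def level_def)
      then have "take (length w) (g ?w) = take (length w) (h ?w)" "?w \<in> lists X"
        using L by (auto simp: L_def level_def)
      then show ?thesis using tree_auts_take[OF gt] tree_auts_take[OF ht] by simp
    qed
    show "g = h"
    proof (rule tree_auts_eqI[OF gt ht])
      fix w assume w: "w \<in> lists X"
      show "g w = h w"
      proof (cases "length w \<le> n")
        case True
        with short w show ?thesis by simp
      next
        case False
        then obtain v u where v: "w = v @ u" "v \<in> level X n" and u: "u \<in> lists X"
          using level_splitE[OF w, of n] by auto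
        obtain p where p: "p \<in> P" "\<And>u. u \<in> lists X \<Longrightarrow> g (v @ u) = g v @ directed p u"
          using directed_beyondE[OF g v(2)] by blast
        obtain q where q: "q \<in> P" "\<And>u. u \<in> lists X \<Longrightarrow> h (v @ u) = h v @ directed q u"
          using directed_beyondE[OF h v(2)] by blast
        have gv: "g v = h v" using short v(2) by (simp add: level_def)
        have "p x = q x" for x
        proof (cases "x \<in> X - {0}")
          case True
          then have "g (v @ [x]) = h (v @ [x])" using short v(2) by (simp add: level_def)
          then show ?thesis using p(2)[of "[x]"] q(2)[of "[x]"] gv True by simp
        next
          case False
          then show ?thesis
            using permutes_not_in[OF permutes[OF p(1)]] permutes_not_in[OF permutes[OF q(1)]] by metis
        qed
        then have "p = q" by blast
        then show ?thesis using p(2)[OF u] q(2)[OF u] v(1) gv by simp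
      qed
    qed
  qed
  moreover have "(\<lambda>g. restrict g L) ` directed_beyond X P n \<subseteq> L \<rightarrow>\<^sub>E L"
    using tree_auts_level directed_beyondD unfolding L_def by (fastforce simp: PiE_def)
  moreover have "finite (L \<rightarrow>\<^sub>E L)"
    unfolding L_def by (intro finite_PiE finite_level finite_letters)
  ultimately show ?thesis by (meson finite_imageD finite_subset)
qed

lemma periodic_eventually_directed: "periodic_group (tree_group X (eventually_directed X P))"
proof -
  let ?G = "tree_group X (eventually_directed X P)"
  have grp: "group ?G"
    unfolding tree_group_def
    by (rule subgroup.subgroup_is_group[OF subgroup_eventually_directed group_Aut_tree])
  have "\<exists>k::nat. k > 0 \<and> g [^]\<^bsub>?G\<^esub> k = \<one>\<^bsub>?G\<^esub>" if g: "g \<in> carrier ?G" for g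
  proof -
    obtain n where n: "g \<in> directed_beyond X P n"
      using g by (auto simp: tree_group_def eventually_directed_def)
    let ?H = "Aut_tree X\<lparr>carrier := directed_beyond X P n\<rparr>"
    interpret H: group ?H
      by (rule subgroup.subgroup_is_group[OF subgroup_directed_beyond group_Aut_tree])
    have "g [^]\<^bsub>?H\<^esub> order ?H = \<one>\<^bsub>?H\<^esub>" using H.pow_order_eq_1[of g] n by simp
    moreover have "order ?H > 0"
      using H.order_gt_0_iff_finite finite_directed_beyond by simp
    moreover have "g [^]\<^bsub>?H\<^esub> k = g [^]\<^bsub>?G\<^esub> k" for k :: nat
      by (simp add: nat_pow_def tree_group_def)
    moreover have "\<one>\<^bsub>?H\<^esub> = \<one>\<^bsub>?G\<^esub>"
      by (simp add: tree_group_def)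
    ultimately show ?thesis by metis
  qed
  then show ?thesis using grp by (simp add: periodic_group_def)
qed

end

section \<open>Splitting an automorphism at a level\<close>

text \<open>
  The action of \<open>g\<close> on the level \<open>n\<close>, continued rigidly below: \<open>g\<close> is the product of this finitary
  automorphism and an automorphism that fixes the level.
\<close>

definition truncate :: "'a set \<Rightarrow> nat \<Rightarrow> ('a list \<Rightarrow> 'a list) \<Rightarrow> 'a list \<Rightarrow> 'a list" where
  "truncate X n g = restrict (\<lambda>w. g (take n w) @ drop n w) (lists X)"

text \<open>
  For \<open>g\<close> fixing the level \<open>n\<close>, the factor of \<open>g\<close> that lives on the subtrees at the vertices in
  \<open>S\<close>.
\<close>

definition part_on :: "'a set \<Rightarrow> nat \<Rightarrow> 'a list set \<Rightarrow> ('a list \<Rightarrow> 'a list) \<Rightarrow> 'a list \<Rightarrow> 'a list" where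
  "part_on X n S g = restrict (\<lambda>w. if take n w \<in> S then g w else w) (lists X)"

lemma take_drop_lists: "w \<in> lists X \<Longrightarrow> take n w \<in> lists X" "w \<in> lists X \<Longrightarrow> drop n w \<in> lists X"
  by (auto dest: in_set_takeD in_set_dropD)

lemma truncate_tree_auts:
  assumes fin: "finite X" and g: "g \<in> tree_auts X"
  shows "truncate X n g \<in> tree_auts X"
  unfolding truncate_def
proof (rule tree_autsI[OF fin])
  fix w assume w: "w \<in> lists X"
  note wt = take_drop_lists[OF w]
  have l: "length (g (take m w)) = min m (length w)" for m
    using tree_auts_length[OF g wt(1)] by (simp add: min.commute)
  show "g (take n w) @ drop n w \<in> lists X"
    using tree_auts_mem[OF g wt(1)] wt(2) by simp
  show "length (g (take n w) @ drop n w) = length w" using l by simp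
  fix m
  show "take m (g (take n w) @ drop n w) = g (take n (take m w)) @ drop n (take m w)"
  proof (cases "m \<le> n")
    case True
    have "take m (g (take n w)) = g (take m (take n w))"
      by (rule tree_auts_take[OF g wt(1)])
    with True l[of n] show ?thesis by (simp add: min_def)
  next
    case False
    with l[of n] show ?thesis by (simp add: min_def drop_take)
  qed
next
  show "inj_on (\<lambda>w. g (take n w) @ drop n w) (lists X)"
  proof (rule inj_onI)
    fix v w assume v: "v \<in> lists X" and w: "w \<in> lists X"
      and eq: "g (take n v) @ drop n v = g (take n w) @ drop n w"
    have "length v = length w"
      using arg_cong[OF eq, of length] tree_auts_length[OF g] take_drop_lists(1)[OF v]
        take_drop_lists(1)[OF w] by simp
    then have "g (take n v) = g (take n w)" "drop n v = drop n w"
      using eq tree_auts_length[OF g] take_drop_lists(1)[OF v] take_drop_lists(1)[OF w] by simp_all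
    then have "take n v = take n w"
      using tree_autsD(4)[OF g] take_drop_lists(1)[OF v] take_drop_lists(1)[OF w]
      by (blast dest: inj_onD)
    with \<open>drop n v = drop n w\<close> show "v = w" by (metis append_take_drop_id)
  qed
qed

lemma truncate_append:
  assumes "v \<in> level X n" "u \<in> lists X"
  shows "truncate X n g (v @ u) = g v @ u"
  using assms by (simp add: truncate_def level_def)

lemma truncate_eq:
  assumes "v \<in> level X n"
  shows "truncate X n g v = g v"
  using assms by (simp add: truncate_def level_def)

lemma truncate_directed_beyond:
  assumes "finite X" "g \<in> tree_auts X"
  shows "truncate X n g \<in> directed_beyond X {id} n"
  using truncate_tree_auts[OF assms] by (simp add: directed_beyond_def truncate_append truncate_eq)

lemma fixes_level_take:
  assumes g: "g \<in> tree_auts X" and fixed: "\<And>v. v \<in> level X n \<Longrightarrow> g v = v" and w: "w \<in> lists X"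
    and "n \<le> length w"
  shows "take n (g w) = take n w"
  using tree_auts_take[OF g w] fixed[of "take n w"] take_drop_lists(1)[OF w] assms(4)
  by (simp add: level_def)

lemma part_on_tree_auts:
  assumes fin: "finite X" and g: "g \<in> tree_auts X"
    and fixed: "\<And>v. v \<in> level X n \<Longrightarrow> g v = v" and S: "S \<subseteq> level X n"
  shows "part_on X n S g \<in> tree_auts X"
  unfolding part_on_def
proof (rule tree_autsI[OF fin])
  have len: "n \<le> length w" if "take n w \<in> S" for w
    using that S by (force simp: level_def)
  have tk: "take n (if take n w \<in> S then g w else w) = take n w" if "w \<in> lists X" for w
    using fixes_level_take[OF g fixed that] len by simp
  fix w assume w: "w \<in> lists X"
  show "(if take n w \<in> S then g w else w) \<in> lists X" using tree_auts_mem[OF g w] w by simp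
  show "length (if take n w \<in> S then g w else w) = length w" using tree_auts_length[OF g w] by simp
  fix m
  show "take m (if take n w \<in> S then g w else w) =
        (if take n (take m w) \<in> S then g (take m w) else take m w)"
  proof (cases "take n w \<in> S")
    case True
    show ?thesis
    proof (cases "n \<le> m")
      case le: True
      then show ?thesis using True tree_auts_take[OF g w] by (simp add: min_def)
    next
      case False
      then have "take m (g w) = take m (take n (g w))" by simp
      also have "\<dots> = take m w" using tk[OF w] True False by simp
      finally have "take m (g w) = take m w" .
      moreover have "take n (take m w) \<notin> S" using len[of "take m w"] False by auto
      ultimately show ?thesis using True by simp
    qed
  next
    case False
    show ?thesis
    proof (cases "n \<le> m")
      case True
      then show ?thesis using False by (simp add: min_def)
    next
      case m: False
      have "take n (take m w) \<notin> S" using len[of "take m w"] m by auto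
      then show ?thesis using False by simp
    qed
  qed
next
  have tk: "take n (if take n w \<in> S then g w else w) = take n w" if "w \<in> lists X" for w
    using fixes_level_take[OF g fixed that] S by (force simp: level_def)
  show "inj_on (\<lambda>w. if take n w \<in> S then g w else w) (lists X)"
  proof (rule inj_onI)
    fix v w assume v: "v \<in> lists X" and w: "w \<in> lists X"
      and eq: "(if take n v \<in> S then g v else v) = (if take n w \<in> S then g w else w)"
    have "take n v = take n w" using arg_cong[OF eq, of "take n"] tk[OF v] tk[OF w] by simp
    with eq have "v = w \<or> g v = g w" by (simp split: if_splits)
    then show "v = w" using tree_autsD(4)[OF g] v w by (blast dest: inj_onD)
  qed
qed

text \<open>
  An automorphism that fixes a level is the product of its parts on the finitely many subtrees at
  that level.
\<close>

lemma mem_of_parts: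
  assumes fin: "finite X" and ne: "X \<noteq> {}" and g: "g \<in> tree_auts X"
    and fixed: "\<And>v. v \<in> level X n \<Longrightarrow> g v = v"
    and H: "subgroup H (Aut_tree X)"
    and parts: "\<And>v. v \<in> level X n \<Longrightarrow> part_on X n {v} g \<in> H"
  shows "g \<in> H"
proof -
  have "part_on X n S g \<in> H" if "S \<subseteq> level X n" for S
  proof -
    have "finite S" using that finite_level[OF fin] finite_subset by blast
    then show ?thesis using that
    proof (induction S)
      case empty
      have "part_on X n {} g = \<one>\<^bsub>Aut_tree X\<^esub>" by (simp add: part_on_def one_Aut_tree)
      then show ?case using subgroup.one_closed[OF H] by simp
    next
      case (insert v S)
      then have v: "v \<in> level X n" "v \<notin> S" and S: "S \<subseteq> level X n" "part_on X n S g \<in> H" by auto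
      note Sa = part_on_tree_auts[OF fin g fixed S(1)]
        and va = part_on_tree_auts[OF fin g fixed, where S = "{v}"]
        and iSa = part_on_tree_auts[OF fin g fixed insert.prems]
      interpret group "Aut_tree X" by (rule group_Aut_tree)
      have "part_on X n (insert v S) g = part_on X n {v} g \<otimes>\<^bsub>Aut_tree X\<^esub> part_on X n S g"
      proof (rule tree_auts_eqI[OF iSa])
        show "part_on X n {v} g \<otimes>\<^bsub>Aut_tree X\<^esub> part_on X n S g \<in> tree_auts X"
          using m_closed va Sa v(1) by simp
        fix w assume w: "w \<in> lists X"
        have "take n (g w) = take n w" if "take n w \<in> S"
        proof (rule fixes_level_take[OF g fixed w])
          show "n \<le> length w" using that S(1) by (force simp: level_def)
        qed
        then show "part_on X n (insert v S) g w =
            (part_on X n {v} g \<otimes>\<^bsub>Aut_tree X\<^esub> part_on X n S g) w"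
          using w v tree_auts_mem[OF g w] va Sa tree_auts_mult[of "part_on X n {v} g" X "part_on X n S g" w]
          by (auto simp: part_on_def)
      qed
      then show ?case
        using subgroup.m_closed[OF H parts[OF v(1)] S(2)] by simp
    qed
  qed
  moreover have "part_on X n (level X n) g = g"
  proof (rule tree_auts_eqI[OF part_on_tree_auts[OF fin g fixed subset_refl] g])
    fix w assume w: "w \<in> lists X"
    show "part_on X n (level X n) g w = g w"
    proof (cases "n \<le> length w")
      case True
      then show ?thesis using w take_drop_lists(1)[OF w] by (simp add: part_on_def level_def)
    next
      case False
      obtain a where "a \<in> X" using ne by blast
      then have l: "w @ replicate (n - length w) a \<in> level X n"
        using w False by (auto simp: level_def)
      have "take (length w) (g (w @ replicate (n - length w) a)) = g w"
        using tree_auts_take[OF g level_lists[OF l], of "length w"] by simp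
      then have "g w = w" using fixed[OF l] by simp
      then show ?thesis using w by (simp add: part_on_def)
    qed
  qed
  ultimately show ?thesis by (metis subset_refl)
qed

section \<open>Exchanging two vertices of one level\<close>

text \<open>
  A finitary involution that carries \<open>u\<close> to \<open>v\<close>: the transpositions act on each coordinate
  separately.
\<close>

fun exchange :: "'a list \<Rightarrow> 'a list \<Rightarrow> 'a list \<Rightarrow> 'a list" where
  "exchange (a # u) (c # v) (x # w) = transpose a c x # exchange u v w"
| "exchange _ _ w = w"

lemma length_exchange [simp]: "length (exchange u v w) = length w"
  by (induction u v w rule: exchange.induct) auto

lemma take_exchange: "take n (exchange u v w) = exchange u v (take n w)"
  by (induction u v w arbitrary: n rule: exchange.induct) (auto simp: take_Cons split: nat.splits)

lemma exchange_exchange [simp]: "exchange u v (exchange u v w) = w"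
  by (induction u v w rule: exchange.induct) auto

lemma exchange_mem:
  "u \<in> lists X \<Longrightarrow> v \<in> lists X \<Longrightarrow> w \<in> lists X \<Longrightarrow> exchange u v w \<in> lists X"
  by (induction u v w rule: exchange.induct) (auto simp: transpose_def)

lemma exchange_append:
  "length u = length v \<Longrightarrow> length z = length u \<Longrightarrow> exchange u v (z @ w) = exchange u v z @ w"
  by (induction u v z rule: exchange.induct) auto

lemma exchange_same: "length u = length v \<Longrightarrow> exchange u v u = v"
  by (induction u v rule: list_induct2) auto

lemma exchange_directed_beyond:
  assumes "finite X" "u \<in> level X n" "v \<in> level X n"
  shows "restrict (exchange u v) (lists X) \<in> directed_beyond X {id} n"
proof -
  have "restrict (exchange u v) (lists X) \<in> tree_auts X"
  proof (rule tree_autsI[OF assms(1)])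
    show "inj_on (exchange u v) (lists X)" by (metis inj_onI exchange_exchange)
    show "exchange u v w \<in> lists X" if "w \<in> lists X" for w
      by (rule exchange_mem[OF level_lists[OF assms(2)] level_lists[OF assms(3)] that])
  qed (simp_all add: take_exchange)
  then show ?thesis
    using assms by (auto simp: directed_beyond_def level_def exchange_append)
qed

lemma spherically_transitive_if_exchange:
  assumes "finite X" "\<And>n. directed_beyond X {id} n \<subseteq> G"
  shows "spherically_transitive X G"
  unfolding spherically_transitive_def
proof (intro allI ballI)
  fix n u v assume uv: "u \<in> level X n" "v \<in> level X n"
  then have "restrict (exchange u v) (lists X) u = v"
    by (simp add: level_def exchange_same)
  then show "\<exists>g\<in>G. g u = v"
    using exchange_directed_beyond[OF assms(1) uv] assms(2) by blast
qed

section \<open>Copies of directed automorphisms in subtrees\<close>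

definition directed_at :: "nat set \<Rightarrow> nat list \<Rightarrow> (nat \<Rightarrow> nat) \<Rightarrow> nat list \<Rightarrow> nat list" where
  "directed_at X v q =
     restrict (\<lambda>w. if prefix v w then v @ directed q (drop (length v) w) else w) (lists X)"

lemma directed_at_append: "v @ u \<in> lists X \<Longrightarrow> directed_at X v q (v @ u) = v @ directed q u"
  by (simp add: directed_at_def)

lemma directed_at_other: "w \<in> lists X \<Longrightarrow> \<not> prefix v w \<Longrightarrow> directed_at X v q w = w"
  by (simp add: directed_at_def)

context letter_perms
begin

lemma directed_at_mem:
  assumes "v \<in> lists X" "q \<in> P" "w \<in> lists X"
  shows "directed_at X v q w \<in> lists X"
  using assms directed_lists[OF assms(2), of "drop (length v) w"] take_drop_lists(2)[OF assms(3)]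
  by (simp add: directed_at_def)

lemma directed_injective:
  assumes q: "q \<in> P" and "directed q v = directed q w"
  shows "v = w"
proof -
  have "directed (inv' q) (directed q u) = u" for u
    using directed_comp[OF permutes[OF q], of "inv' q" u] permutes_inv_o(2)[OF permutes[OF q]]
    by simp
  then show ?thesis using assms(2) by metis
qed

lemma directed_at_tree_auts:
  assumes v: "v \<in> lists X" and q: "q \<in> P"
  shows "directed_at X v q \<in> tree_auts X"
  unfolding directed_at_def
proof (rule tree_autsI[OF finite_letters])
  let ?f = "\<lambda>w. if prefix v w then v @ directed q (drop (length v) w) else w"
  fix w assume w: "w \<in> lists X"
  show "?f w \<in> lists X" using directed_at_mem[OF v q w] w by (simp add: directed_at_def)
  show "length (?f w) = length w" by (auto dest: prefix_length_le)
  fix n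
  show "take n (?f w) = ?f (take n w)"
  proof (cases "prefix v w")
    case True
    then obtain u where u: "w = v @ u" by (auto elim: prefixE)
    show ?thesis
    proof (cases "length v \<le> n")
      case True
      then show ?thesis by (simp add: u take_directed)
    next
      case False
      then have "\<not> prefix v (take n w)" using prefix_length_le[of v "take n w"] by auto
      with False show ?thesis by (simp add: u)
    qed
  next
    case False
    then have "\<not> prefix v (take n w)" using prefix_order.trans[OF _ take_is_prefix] by blast
    with False show ?thesis by simp
  qed
next
  let ?f = "\<lambda>w. if prefix v w then v @ directed q (drop (length v) w) else w"
  show "inj_on ?f (lists X)"
  proof (rule inj_onI)
    fix a b assume eq: "?f a = ?f b"
    have pre: "prefix v (?f w) \<longleftrightarrow> prefix v w" for w by simp
    have "prefix v a \<longleftrightarrow> prefix v b" using eq pre[of a] pre[of b] by metis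
    then show "a = b" using eq directed_injective[OF q]
      by (cases "prefix v a") (auto elim!: prefixE)
  qed
qed

lemma directed_at_directed_beyond:
  assumes v: "v \<in> lists X" and q: "q \<in> P"
  shows "directed_at X v q \<in> directed_beyond X P (length v)"
proof -
  have "\<exists>p\<in>P. \<forall>u\<in>lists X. directed_at X v q (w @ u) = directed_at X v q w @ directed p u"
    if w: "w \<in> level X (length v)" for w
  proof (cases "w = v")
    case True
    then show ?thesis using v q directed_at_append[of v "[]" X q] by (auto simp: directed_at_append)
  next
    case False
    then have "\<not> prefix v (w @ u)" for u
      using w by (auto simp: level_def prefix_def append_eq_append_conv)
    from this[of "[]"] this show ?thesis
      using w id_mem by (auto simp: directed_at_other level_def intro!: bexI[of _ id])
  qed
  then show ?thesis using directed_at_tree_auts[OF assms] by (simp add: directed_beyond_def)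
qed

lemma directed_at_comp:
  assumes v: "v \<in> lists X" and p: "p \<in> P" and q: "q \<in> P"
  shows "directed_at X v (p \<circ> q) = directed_at X v p \<otimes>\<^bsub>Aut_tree X\<^esub> directed_at X v q"
proof -
  interpret group "Aut_tree X" by (rule group_Aut_tree)
  note pt = directed_at_tree_auts[OF v p] and qt = directed_at_tree_auts[OF v q]
  show ?thesis
  proof (rule tree_auts_eqI)
    show "directed_at X v (p \<circ> q) \<in> tree_auts X" by (rule directed_at_tree_auts[OF v comp_mem[OF p q]])
    show "directed_at X v p \<otimes>\<^bsub>Aut_tree X\<^esub> directed_at X v q \<in> tree_auts X" using m_closed pt qt by simp
    fix w assume w: "w \<in> lists X"
    show "directed_at X v (p \<circ> q) w = (directed_at X v p \<otimes>\<^bsub>Aut_tree X\<^esub> directed_at X v q) w"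
      unfolding tree_auts_mult[OF pt qt w]
    proof (cases "prefix v w")
      case True
      then obtain u where u: "w = v @ u" by (auto elim: prefixE)
      have "v @ directed q u \<in> lists X" using directed_at_mem[OF v q w] w by (simp add: u directed_at_append)
      then show "directed_at X v (p \<circ> q) w = directed_at X v p (directed_at X v q w)"
        using w by (simp add: u directed_at_append directed_comp[OF permutes[OF q]])
    qed (use w in \<open>simp add: directed_at_other\<close>)
  qed
qed

lemma directed_at_id: "directed_at X v id = \<one>\<^bsub>Aut_tree X\<^esub>"
  unfolding directed_at_def one_Aut_tree
  by (rule restrict_ext) (auto elim!: prefixE simp del: append_assoc)

lemma directed_at_inv:
  assumes v: "v \<in> lists X" and q: "q \<in> P"
  shows "directed_at X v (inv' q) = inv\<^bsub>Aut_tree X\<^esub> directed_at X v q"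
proof -
  interpret A: group "Aut_tree X" by (rule group_Aut_tree)
  have "directed_at X v (inv' q) \<otimes>\<^bsub>Aut_tree X\<^esub> directed_at X v q = \<one>\<^bsub>Aut_tree X\<^esub>"
    using directed_at_comp[OF v inv_mem[OF q] q] permutes_inv_o(2)[OF permutes[OF q]] directed_at_id by simp
  then show ?thesis
    using A.inv_equality directed_at_tree_auts[OF v] q inv_mem[OF q] by (metis carrier_Aut_tree)
qed

lemma directed_at_commute:
  assumes v: "v \<in> lists X" and w: "w \<in> lists X" and p: "p \<in> P" and q: "q \<in> P"
    and vw: "\<not> prefix v w" "\<not> prefix w v"
  shows "directed_at X v p \<otimes>\<^bsub>Aut_tree X\<^esub> directed_at X w q =
         directed_at X w q \<otimes>\<^bsub>Aut_tree X\<^esub> directed_at X v p"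
proof -
  interpret group "Aut_tree X" by (rule group_Aut_tree)
  note pt = directed_at_tree_auts[OF v p] and qt = directed_at_tree_auts[OF w q]
  have disj: "\<not> prefix v z \<or> \<not> prefix w z" for z
    using vw prefix_same_cases by blast
  show ?thesis
  proof (rule tree_auts_eqI)
    show "directed_at X v p \<otimes>\<^bsub>Aut_tree X\<^esub> directed_at X w q \<in> tree_auts X"
      "directed_at X w q \<otimes>\<^bsub>Aut_tree X\<^esub> directed_at X v p \<in> tree_auts X"
      using m_closed pt qt by simp_all
    fix z assume z: "z \<in> lists X"
    have pre: "prefix a (directed_at X a r z) \<longleftrightarrow> prefix a z" for a r
      using z by (simp add: directed_at_def)
    show "(directed_at X v p \<otimes>\<^bsub>Aut_tree X\<^esub> directed_at X w q) z =
         (directed_at X w q \<otimes>\<^bsub>Aut_tree X\<^esub> directed_at X v p) z"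
      unfolding tree_auts_mult[OF pt qt z] tree_auts_mult[OF qt pt z]
    proof (cases "prefix v z")
      case True
      then have "\<not> prefix w z" "\<not> prefix w (directed_at X v p z)"
        using disj[of z] disj[of "directed_at X v p z"] pre[of v p] by auto
      then show "directed_at X v p (directed_at X w q z) = directed_at X w q (directed_at X v p z)"
        using z directed_at_mem[OF v p z] by (simp add: directed_at_other)
    next
      case nv: False
      show "directed_at X v p (directed_at X w q z) = directed_at X w q (directed_at X v p z)"
      proof (cases "prefix w z")
        case True
        then have "\<not> prefix v (directed_at X w q z)"
          using disj[of "directed_at X w q z"] pre[of w q] by auto
        then show ?thesis using nv z directed_at_mem[OF w q z] by (simp add: directed_at_other)
      qed (use nv z in \<open>simp add: directed_at_other\<close>)
    qed
  qed
qed

lemma directed_at_conj: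
  assumes v: "v \<in> level X n" and w: "w \<in> level X n" and q: "q \<in> P"
  defines "t \<equiv> restrict (exchange v w) (lists X)"
  shows "directed_at X w q = t \<otimes>\<^bsub>Aut_tree X\<^esub> (directed_at X v q \<otimes>\<^bsub>Aut_tree X\<^esub> t)"
proof -
  interpret group "Aut_tree X" by (rule group_Aut_tree)
  note vl = level_lists[OF v] and wl = level_lists[OF w]
  have tt: "t \<in> tree_auts X"
    unfolding t_def using directed_beyondD exchange_directed_beyond[OF finite_letters v w] by blast
  note qv = directed_at_tree_auts[OF vl q] and qw = directed_at_tree_auts[OF wl q]
  have qvt: "directed_at X v q \<otimes>\<^bsub>Aut_tree X\<^esub> t \<in> tree_auts X" using m_closed qv tt by simp
  have len: "length v = length w" using v w by (simp add: level_def)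
  have ex: "exchange v w (v @ u) = w @ u" for u
    using exchange_append[OF len, of v u] exchange_same[OF len] len by simp
  have ex': "exchange v w (w @ u) = v @ u" for u
    using ex[of u] exchange_exchange by metis
  show ?thesis
  proof (rule tree_auts_eqI[OF qw])
    show "t \<otimes>\<^bsub>Aut_tree X\<^esub> (directed_at X v q \<otimes>\<^bsub>Aut_tree X\<^esub> t) \<in> tree_auts X"
      using m_closed qvt tt by simp
    fix z assume z: "z \<in> lists X"
    note tz = tree_auts_mem[OF tt z]
    show "directed_at X w q z = (t \<otimes>\<^bsub>Aut_tree X\<^esub> (directed_at X v q \<otimes>\<^bsub>Aut_tree X\<^esub> t)) z"
      unfolding tree_auts_mult[OF tt qvt z] tree_auts_mult[OF qv tt z]
    proof (cases "prefix w z")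
      case True
      then obtain u where u: "z = w @ u" by (auto elim: prefixE)
      have tzu: "t z = v @ u" using z by (simp add: t_def u ex')
      have "v @ directed q u \<in> lists X"
        using directed_at_mem[OF vl q tz] tz by (simp add: tzu directed_at_append)
      then show "directed_at X w q z = t (directed_at X v q (t z))"
        using z tz unfolding tzu by (simp add: directed_at_append t_def ex u)
    next
      case False
      have "\<not> prefix v (t z)"
      proof
        assume "prefix v (t z)"
        then obtain u where "exchange v w z = v @ u" using z by (auto simp: t_def elim: prefixE)
        then have "z = w @ u" using ex[of u] exchange_exchange by metis
        with False show False by simp
      qed
      then show "directed_at X w q z = t (directed_at X v q (t z))"
        using False z tz by (simp add: directed_at_other) (simp add: t_def)
    qed
  qed
qed

text \<open>
  The section of \<open>\<beta>\<^sub>q\<close> at \<open>0\<^sup>n\<close> is \<open>\<beta>\<^sub>q\<close>, and all other sections at the level \<open>n\<close> are trivial.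
\<close>

lemma directed_at_root_eq:
  assumes q: "q \<in> P"
  shows "directed_at X [] q =
    truncate X n (directed_at X [] q) \<otimes>\<^bsub>Aut_tree X\<^esub> directed_at X (replicate n 0) q"
proof -
  interpret group "Aut_tree X" by (rule group_Aut_tree)
  let ?o = "replicate n (0::nat)"
  have o: "?o \<in> lists X" "?o \<in> level X n" using zero_letter by (auto simp: level_def)
  have rt: "directed_at X [] q \<in> tree_auts X" using directed_at_tree_auts q by simp
  note ot = directed_at_tree_auts[OF o(1) q] and tt = truncate_tree_auts[OF finite_letters rt]
  have ev: "directed_at X [] q w = directed q w" if "w \<in> lists X" for w
    using that by (simp add: directed_at_def)
  show ?thesis
  proof (rule tree_auts_eqI[OF rt])
    show "truncate X n (directed_at X [] q) \<otimes>\<^bsub>Aut_tree X\<^esub> directed_at X ?o q \<in> tree_auts X"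
      using m_closed tt ot by simp
    fix w assume w: "w \<in> lists X"
    have zeros: "directed q (replicate k 0 @ z) = replicate k 0 @ directed q z" for k z
      by (induction k) auto
    show "directed_at X [] q w =
        (truncate X n (directed_at X [] q) \<otimes>\<^bsub>Aut_tree X\<^esub> directed_at X ?o q) w"
      unfolding tree_auts_mult[OF tt ot w]
    proof (cases "prefix ?o w")
      case True
      then obtain u where u: "w = ?o @ u" by (auto elim: prefixE)
      have "u \<in> lists X" using w u by simp
      then have "directed q u \<in> lists X" by (rule directed_lists[OF q])
      then have "truncate X n (directed_at X [] q) (?o @ directed q u) = ?o @ directed q u"
        using truncate_append[OF o(2)] ev[OF o(1)] zeros[of n "[]"] by simp
      then show "directed_at X [] q w = truncate X n (directed_at X [] q) (directed_at X ?o q w)"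
        using w ev[OF w] by (simp add: u directed_at_append zeros)
    next
      case False
      have "drop n w = [] \<or> \<not> set (take n w) \<subseteq> {0}"
      proof (rule ccontr)
        assume "\<not> (drop n w = [] \<or> \<not> set (take n w) \<subseteq> {0})"
        then have "length (take n w) = n" "\<forall>x\<in>set (take n w). x = 0" by auto
        then have "take n w = ?o" by (metis replicate_eqI)
        with False show False using take_is_prefix[of n w] by simp
      qed
      then have "directed q w = directed q (take n w) @ drop n w"
        using directed_append[of q "take n w" "drop n w"] by auto
      then show "directed_at X [] q w = truncate X n (directed_at X [] q) (directed_at X ?o q w)"
        using False w ev[OF w] ev[OF take_drop_lists(1)[OF w]]
        by (simp add: directed_at_other truncate_def)
    qed
  qed
qed

end

section \<open>Two facts about abstract groups\<close>

text \<open>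
  Finiteness of \<open>B\<close> is what makes unions of chains proper: a union that contains \<open>B\<close> has a member
  that contains \<open>B\<close>.
\<close>

lemma maximal_subgroup_above:
  fixes G (structure)
  assumes "group G" and F: "subgroup F G" and "finite B" and "\<not> B \<subseteq> F"
    and gen: "\<And>H. \<lbrakk>subgroup H G; F \<subseteq> H; B \<subseteq> H\<rbrakk> \<Longrightarrow> H = carrier G"
    and BG: "B \<subseteq> carrier G"
  shows "\<exists>M. maximal_subgroup M G \<and> F \<subseteq> M"
proof -
  interpret group G by fact
  define \<A> where "\<A> = {H. subgroup H G \<and> F \<subseteq> H \<and> \<not> B \<subseteq> H}"
  have "\<exists>M\<in>\<A>. \<forall>H\<in>\<A>. M \<subseteq> H \<longrightarrow> H = M"
  proof (rule subset_Zorn_nonempty)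
    show "\<A> \<noteq> {}" using F assms(4) by (auto simp: \<A>_def)
  next
    fix \<C> assume ne: "\<C> \<noteq> {}" and ch: "subset.chain \<A> \<C>"
    then have C: "subgroup H G" "F \<subseteq> H" "\<not> B \<subseteq> H" if "H \<in> \<C>" for H
      using that unfolding subset.chain_def \<A>_def by blast+
    have lin: "H \<subseteq> K \<or> K \<subseteq> H" if "H \<in> \<C>" "K \<in> \<C>" for H K
      using ch that unfolding subset.chain_def by blast
    have "subgroup (\<Union>\<C>) G"
    proof (rule subgroupI)
      show "\<Union>\<C> \<subseteq> carrier G"
        by (rule Union_least) (rule subgroup.subset[OF C(1)])
      obtain H where "H \<in> \<C>" using ne by blast
      then show "\<Union>\<C> \<noteq> {}" using subgroup.one_closed[OF C(1)] by blast
      show "inv a \<in> \<Union>\<C>" if a: "a \<in> \<Union>\<C>" for a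
      proof -
        obtain H where "H \<in> \<C>" "a \<in> H" using a by blast
        then show ?thesis using subgroup.m_inv_closed[OF C(1)] by blast
      qed
      show "a \<otimes> b \<in> \<Union>\<C>" if ab: "a \<in> \<Union>\<C>" "b \<in> \<Union>\<C>" for a b
      proof -
        obtain H K where "H \<in> \<C>" "a \<in> H" "K \<in> \<C>" "b \<in> K" using ab by blast
        then obtain L where "L \<in> \<C>" "a \<in> L" "b \<in> L" using lin by blast
        then show ?thesis using subgroup.m_closed[OF C(1)] by blast
      qed
    qed
    moreover have "F \<subseteq> \<Union>\<C>" using C(2) ne by blast
    moreover have "\<not> B \<subseteq> \<Union>\<C>"
      using finite_subset_Union_chain[OF \<open>finite B\<close> _ ne ch] C(3) by metis
    ultimately show "\<Union>\<C> \<in> \<A>" by (simp add: \<A>_def)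
  qed
  then obtain M where M: "M \<in> \<A>" and max: "\<And>H. H \<in> \<A> \<Longrightarrow> M \<subseteq> H \<Longrightarrow> H = M" by blast
  have "maximal_subgroup M G"
    unfolding maximal_subgroup_def
  proof (intro conjI allI impI)
    show "subgroup M G" "M \<noteq> carrier G" using M BG by (auto simp: \<A>_def)
    show "H = M \<or> H = carrier G" if "subgroup H G \<and> M \<subseteq> H" for H
    proof (cases "B \<subseteq> H")
      case True
      then show ?thesis using gen that M by (auto simp: \<A>_def)
    next
      case False
      then show ?thesis using max that M by (auto simp: \<A>_def)
    qed
  qed
  then show ?thesis using M by (auto simp: \<A>_def)
qed

text \<open>
  The commutator of \<open>a \<otimes> c\<close> and \<open>b \<otimes> d\<close> is the commutator of \<open>a\<close> and \<open>b\<close>, as \<open>c\<close> commutes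
  with \<open>b\<close> and \<open>d\<close>, and \<open>d\<close> commutes with \<open>a\<close>.
\<close>

lemma (in group) mem_subgroup_of_commuting_products:
  assumes H: "subgroup H G"
    and ab: "a \<otimes> c \<in> H" "b \<otimes> d \<in> H"
    and car: "a \<in> carrier G" "b \<in> carrier G" "c \<in> carrier G" "d \<in> carrier G"
    and com: "a \<otimes> d = d \<otimes> a" "b \<otimes> c = c \<otimes> b" "c \<otimes> d = d \<otimes> c"
  shows "(a \<otimes> b) \<otimes> inv (b \<otimes> a) \<in> H"
proof -
  have 1: "(a \<otimes> c) \<otimes> (b \<otimes> d) = (a \<otimes> b) \<otimes> (c \<otimes> d)"
  proof -
    have "(a \<otimes> c) \<otimes> (b \<otimes> d) = a \<otimes> ((c \<otimes> b) \<otimes> d)" using car by (simp add: m_assoc)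
    also have "\<dots> = a \<otimes> ((b \<otimes> c) \<otimes> d)" by (simp only: com(2))
    also have "\<dots> = (a \<otimes> b) \<otimes> (c \<otimes> d)" using car by (simp add: m_assoc)
    finally show ?thesis .
  qed
  have 2: "(b \<otimes> d) \<otimes> (a \<otimes> c) = (b \<otimes> a) \<otimes> (c \<otimes> d)"
  proof -
    have "(b \<otimes> d) \<otimes> (a \<otimes> c) = b \<otimes> ((d \<otimes> a) \<otimes> c)" using car by (simp add: m_assoc)
    also have "\<dots> = b \<otimes> ((a \<otimes> d) \<otimes> c)" by (simp only: com(1))
    also have "\<dots> = (b \<otimes> a) \<otimes> (d \<otimes> c)" using car by (simp add: m_assoc)
    finally show ?thesis by (simp only: com(3))
  qed
  have "((a \<otimes> b) \<otimes> (c \<otimes> d)) \<otimes> inv ((b \<otimes> a) \<otimes> (c \<otimes> d)) \<in> H"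
    using H ab 1 2 by (metis subgroup.m_closed subgroup.m_inv_closed)
  also have "((a \<otimes> b) \<otimes> (c \<otimes> d)) \<otimes> inv ((b \<otimes> a) \<otimes> (c \<otimes> d)) =
      (a \<otimes> b) \<otimes> (((c \<otimes> d) \<otimes> inv (c \<otimes> d)) \<otimes> inv (b \<otimes> a))"
    using car by (simp add: inv_mult_group m_assoc)
  also have "\<dots> = (a \<otimes> b) \<otimes> inv (b \<otimes> a)"
    using car by simp
  finally show ?thesis .
qed

section \<open>The branch property and generation\<close>

context letter_perms
begin

lemma finitary_subset: "directed_beyond X {id} n \<subseteq> directed_beyond X P n"
  using id_mem unfolding directed_beyond_def by fastforce

text \<open>
  Below a level at which \<open>g\<close> is directed, the part of \<open>g\<close> on \<open>S\<close> acts in each subtree as \<open>g\<close> does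
  or trivially.
\<close>

lemma part_on_eventually_directed:
  assumes g: "g \<in> eventually_directed X P" and fixed: "\<And>v. v \<in> level X n \<Longrightarrow> g v = v"
    and S: "S \<subseteq> level X n"
  shows "part_on X n S g \<in> eventually_directed X P"
proof -
  obtain k where "g \<in> directed_beyond X P k" using g by (auto simp: eventually_directed_def)
  then have gm: "g \<in> directed_beyond X P (max k n)"
    using directed_beyond_mono[of k "max k n"] by auto
  note gt = directed_beyondD[OF gm]
  have "\<exists>q\<in>P. \<forall>u\<in>lists X. part_on X n S g (v @ u) = part_on X n S g v @ directed q u"
    if v: "v \<in> level X (max k n)" for v
  proof (cases "take n v \<in> S")
    case True
    obtain q where "q \<in> P" "\<And>u. u \<in> lists X \<Longrightarrow> g (v @ u) = g v @ directed q u"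
      using directed_beyondE[OF gm v] by blast
    then show ?thesis
      using True v by (auto simp: part_on_def level_def intro!: bexI[of _ q])
  next
    case False
    then show ?thesis
      using v id_mem by (auto simp: part_on_def level_def intro!: bexI[of _ id])
  qed
  then have "part_on X n S g \<in> directed_beyond X P (max k n)"
    using part_on_tree_auts[OF finite_letters gt fixed S] by (simp add: directed_beyond_def)
  then show ?thesis by (auto simp: eventually_directed_def)
qed

text \<open>
  Two elements with the same action on the level \<open>n\<close> differ by an element fixing this level, whose
  parts on the subtrees lie in the rigid stabilisers.  So the index of \<open>Rist X G n\<close> is at most the
  number of permutations of the level.
\<close>

lemma branch_group_eventually_directed: "branch_group X (eventually_directed X P)"
proof -
  define G where "G = eventually_directed X P"
  let ?T = "tree_group X G"
  have G: "subgroup G (Aut_tree X)" unfolding G_def by (rule subgroup_eventually_directed)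
  interpret A: group "Aut_tree X" by (rule group_Aut_tree)
  interpret T: group ?T unfolding tree_group_def by (rule subgroup.subgroup_is_group[OF G group_Aut_tree])
  have carT: "carrier ?T = G" by (simp add: tree_group_def)
  have GA: "g \<in> tree_auts X" if "g \<in> G" for g using subgroup.subset[OF G] that by auto
  have invT: "inv\<^bsub>?T\<^esub> g = inv\<^bsub>Aut_tree X\<^esub> g" if "g \<in> G" for g
    using that unfolding tree_group_def by (rule A.m_inv_consistent[OF G])
  have "finite_index (Rist X G n) ?T" for n
  proof (rule finite_indexI[where \<phi> = "\<lambda>g. restrict g (level X n)"])
    have rist: "(\<Union>v\<in>level X n. rist X G v) \<subseteq> carrier ?T" by (auto simp: rist_def carT)
    show R: "subgroup (Rist X G n) ?T"
      unfolding Rist_def by (rule T.generate_is_subgroup[OF rist])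
    show "group ?T" by (rule T.is_group)
    have "(\<lambda>g. restrict g (level X n)) ` carrier ?T \<subseteq> level X n \<rightarrow>\<^sub>E level X n"
      using tree_auts_level GA by (fastforce simp: carT PiE_def)
    then show "finite ((\<lambda>g. restrict g (level X n)) ` carrier ?T)"
      by (rule finite_subset) (intro finite_PiE finite_level finite_letters)
    fix g h assume g: "g \<in> carrier ?T" and h: "h \<in> carrier ?T"
      and eq: "restrict g (level X n) = restrict h (level X n)"
    define k where "k = g \<otimes>\<^bsub>?T\<^esub> inv\<^bsub>?T\<^esub> h"
    have kG: "k \<in> G" using g h T.m_closed T.inv_closed unfolding k_def carT by blast
    have fixed: "k v = v" if v: "v \<in> level X n" for v
    proof -
      have ht: "h \<in> tree_auts X" and gt: "g \<in> tree_auts X"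
        and it: "inv\<^bsub>Aut_tree X\<^esub> h \<in> tree_auts X"
        using g h GA A.inv_closed by (simp_all add: carT)
      have "k v = (g \<otimes>\<^bsub>Aut_tree X\<^esub> inv\<^bsub>Aut_tree X\<^esub> h) v"
        using h invT by (simp add: k_def carT) (simp add: tree_group_def)
      also have "\<dots> = g ((inv\<^bsub>Aut_tree X\<^esub> h) v)" by (rule tree_auts_mult[OF gt it level_lists[OF v]])
      also have "\<dots> = h ((inv\<^bsub>Aut_tree X\<^esub> h) v)"
        using eq tree_auts_level[OF it v] by (metis restrict_apply')
      also have "\<dots> = v" by (rule tree_auts_inv(2)[OF ht level_lists[OF v]])
      finally show ?thesis .
    qed
    have "k \<in> Rist X G n"
    proof (rule mem_of_parts[OF finite_letters _ GA[OF kG] fixed])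
      show "X \<noteq> {}" using zero_letter by blast
      show "subgroup (Rist X G n) (Aut_tree X)" using R subgroup_tree_group_iff[OF G] by blast
      fix v assume v: "v \<in> level X n"
      have "part_on X n {v} k \<in> rist X G v"
        unfolding rist_def
      proof (intro CollectI conjI ballI impI)
        show "part_on X n {v} k \<in> G"
          using part_on_eventually_directed[OF kG[unfolded G_def] fixed] v by (simp add: G_def)
        fix u assume "u \<in> lists X" "\<not> prefix v u"
        then show "part_on X n {v} k u = u"
          using take_is_prefix[of n u] by (auto simp: part_on_def)
      qed
      then show "part_on X n {v} k \<in> Rist X G n"
        unfolding Rist_def using v generate.incl by (metis UN_I)
    qed
    then show "g \<otimes>\<^bsub>?T\<^esub> inv\<^bsub>?T\<^esub> h \<in> Rist X G n" by (simp add: k_def)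
  qed
  moreover have "spherically_transitive X G"
    unfolding G_def eventually_directed_def
    by (rule spherically_transitive_if_exchange[OF finite_letters]) (use finitary_subset in blast)
  ultimately show ?thesis
    using finite_letters zero_letter G unfolding branch_group_def G_def by blast
qed

text \<open>
  If \<open>g\<close> is directed below the level \<open>n\<close>, it is the product of a finitary element and of copies of
  some \<open>\<beta>\<^sub>q\<close> at the vertices of this level.  The subgroup \<open>H\<close> contains the copy at \<open>0\<^sup>n\<close>, which differs from \<open>\<beta>\<^sub>q\<close> by a finitary factor,
  and hence the copy at any vertex, by conjugation with a finitary element.
\<close>

lemma eventually_directed_generated:
  assumes H: "subgroup H (Aut_tree X)" and F: "eventually_directed X {id} \<subseteq> H"
    and B: "\<And>q. q \<in> P \<Longrightarrow> directed_at X [] q \<in> H"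
  shows "eventually_directed X P \<subseteq> H"
proof
  interpret A: group "Aut_tree X" by (rule group_Aut_tree)
  have HA: "h \<in> tree_auts X" if "h \<in> H" for h using subgroup.subset[OF H] that by auto
  have Hn: "directed_beyond X {id} n \<subseteq> H" for n using F by (auto simp: eventually_directed_def)
  have at: "directed_at X v q \<in> H" if v: "v \<in> lists X" and q: "q \<in> P" for v q
  proof -
    define n where "n = length v"
    let ?o = "replicate n (0::nat)"
    have vn: "v \<in> level X n" "?o \<in> level X n" using v zero_letter by (auto simp: level_def n_def)
    define t where "t = truncate X n (directed_at X [] q)"
    have rt: "directed_at X [] q \<in> tree_auts X" using directed_at_tree_auts[OF _ q] by simp
    have tH: "t \<in> H" unfolding t_def using truncate_directed_beyond[OF finite_letters rt] Hn by blast
    have "directed_at X ?o q = inv\<^bsub>Aut_tree X\<^esub> t \<otimes>\<^bsub>Aut_tree X\<^esub> directed_at X [] q"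
      using directed_at_root_eq[OF q, of n] A.inv_solve_left[of "directed_at X ?o q" t "directed_at X [] q"]
        HA[OF tH] rt directed_at_tree_auts[OF level_lists[OF vn(2)] q] by (simp add: t_def)
    then have "directed_at X ?o q \<in> H"
      using subgroup.m_closed[OF H subgroup.m_inv_closed[OF H tH] B[OF q]] by simp
    moreover have "restrict (exchange ?o v) (lists X) \<in> H"
      using exchange_directed_beyond[OF finite_letters vn(2,1)] Hn by blast
    ultimately show ?thesis
      unfolding directed_at_conj[OF vn(2,1) q] by (intro subgroup.m_closed[OF H])
  qed
  fix g assume "g \<in> eventually_directed X P"
  then obtain n where g: "g \<in> directed_beyond X P n" by (auto simp: eventually_directed_def)
  note gt = directed_beyondD[OF g]
  define t where "t = truncate X n g"
  have tH: "t \<in> H" unfolding t_def using truncate_directed_beyond[OF finite_letters gt] Hn by blast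
  note tt = HA[OF tH]
  have it: "inv\<^bsub>Aut_tree X\<^esub> t \<in> tree_auts X" using A.inv_closed tt by simp
  define h where "h = inv\<^bsub>Aut_tree X\<^esub> t \<otimes>\<^bsub>Aut_tree X\<^esub> g"
  have ht: "h \<in> tree_auts X" using A.m_closed it gt by (simp add: h_def)
  have h_append: "h (v @ u) = v @ directed q u"
    if v: "v \<in> level X n" and u: "u \<in> lists X" and q: "q \<in> P" and
      gq: "\<And>u. u \<in> lists X \<Longrightarrow> g (v @ u) = g v @ directed q u" for v u q
  proof -
    have u': "directed q u \<in> lists X" by (rule directed_lists[OF q u])
    have "h (v @ u) = (inv\<^bsub>Aut_tree X\<^esub> t) (g (v @ u))"
      using tree_auts_mult[OF it gt, of "v @ u"] level_lists[OF v] u by (simp add: h_def)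
    also have "g (v @ u) = t (v @ directed q u)"
      unfolding t_def using gq[OF u] truncate_append[OF v u'] by simp
    also have "(inv\<^bsub>Aut_tree X\<^esub> t) (t (v @ directed q u)) = v @ directed q u"
      using tree_auts_inv(1)[OF tt, of "v @ directed q u"] level_lists[OF v] u' by simp
    finally show ?thesis .
  qed
  have fixed: "h v = v" if v: "v \<in> level X n" for v
  proof -
    obtain q where "q \<in> P" "\<And>u. u \<in> lists X \<Longrightarrow> g (v @ u) = g v @ directed q u"
      using directed_beyondE[OF g v] by blast
    then show ?thesis using h_append[OF v, of "[]" q] by simp
  qed
  have "h \<in> H"
  proof (rule mem_of_parts[OF finite_letters _ ht fixed H])
    show "X \<noteq> {}" using zero_letter by blast
    fix v assume v: "v \<in> level X n"
    obtain q where q: "q \<in> P" "\<And>u. u \<in> lists X \<Longrightarrow> g (v @ u) = g v @ directed q u"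
      using directed_beyondE[OF g v] by blast
    have "part_on X n {v} h = directed_at X v q"
    proof (rule tree_auts_eqI)
      show "part_on X n {v} h \<in> tree_auts X"
        using part_on_tree_auts[OF finite_letters ht fixed] v by simp
      show "directed_at X v q \<in> tree_auts X" by (rule directed_at_tree_auts[OF level_lists[OF v] q(1)])
      fix w assume w: "w \<in> lists X"
      have tk: "take n w = v \<longleftrightarrow> prefix v w"
        using v take_is_prefix[of n w] by (auto simp: level_def elim!: prefixE)
      show "part_on X n {v} h w = directed_at X v q w"
      proof (cases "prefix v w")
        case True
        then obtain u where u: "w = v @ u" by (auto elim: prefixE)
        then have "u \<in> lists X" using w by simp
        then show ?thesis
          using True tk w h_append[OF v _ q] by (simp add: part_on_def directed_at_def u)
      next
        case False
        then show ?thesis using tk w by (simp add: part_on_def directed_at_def)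
      qed
    qed
    then show "part_on X n {v} h \<in> H" using at[OF level_lists[OF v] q(1)] by simp
  qed
  moreover have "g = t \<otimes>\<^bsub>Aut_tree X\<^esub> h"
    unfolding h_def using tt gt it A.r_inv by (simp add: A.m_assoc[symmetric])
  ultimately show "g \<in> H" using subgroup.m_closed[OF H tH] by simp
qed

text \<open>
  Conjugation moves the copy at \<open>v\<close> to \<open>0\<^sup>n\<close>, where \<open>n\<close> is the length of \<open>v\<close>, and a finitary factor
  turns the copy at \<open>0\<^sup>n\<close> into \<open>\<beta>\<^sub>q\<close> itself.
\<close>

lemma directed_at_root_mem:
  assumes H: "subgroup H (Aut_tree X)" and F: "eventually_directed X {id} \<subseteq> H"
    and q: "q \<in> P" and v: "v \<in> lists X" and mem: "directed_at X v q \<in> H"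
  shows "directed_at X [] q \<in> H"
proof -
  define n where "n = length v"
  let ?o = "replicate n (0::nat)"
  have vn: "v \<in> level X n" "?o \<in> level X n" using v zero_letter by (auto simp: level_def n_def)
  have Hn: "directed_beyond X {id} n \<subseteq> H" using F by (auto simp: eventually_directed_def)
  have "restrict (exchange v ?o) (lists X) \<in> H"
    using exchange_directed_beyond[OF finite_letters vn] Hn by blast
  then have "directed_at X ?o q \<in> H"
    unfolding directed_at_conj[OF vn q] using mem by (intro subgroup.m_closed[OF H])
  moreover have "truncate X n (directed_at X [] q) \<in> H"
    using truncate_directed_beyond[OF finite_letters directed_at_tree_auts[OF _ q, of "[]"]] Hn by auto
  ultimately show ?thesis
    using directed_at_root_eq[OF q, of n] subgroup.m_closed[OF H] by metis
qed

end

section \<open>A maximal subgroup of infinite index\<close>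

text \<open>
  Perfectness, in the form of an induction principle with the commutators as base cases; it is
  applied to the set of all \<open>q \<in> Q\<close> with \<open>\<beta>\<^sub>q\<close> in a given subgroup.
\<close>

locale perfect_letter_perms = letter_perms X Q for X Q +
  assumes nontrivial: "Q \<noteq> {id}"
    and perfect: "\<lbrakk>id \<in> K; \<And>p q. p \<in> K \<Longrightarrow> q \<in> K \<Longrightarrow> p \<circ> q \<in> K; \<And>p. p \<in> K \<Longrightarrow> inv' p \<in> K;
      \<And>p q. p \<in> Q \<Longrightarrow> q \<in> Q \<Longrightarrow> p \<circ> q \<circ> inv' p \<circ> inv' q \<in> K\<rbrakk> \<Longrightarrow> Q \<subseteq> K"
begin

lemma moved_letter:
  obtains q a where "q \<in> Q" "a \<in> X - {0}" "q a \<noteq> a"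
proof -
  obtain q where q: "q \<in> Q" "q \<noteq> id" using nontrivial id_mem by blast
  then obtain a where a: "q a \<noteq> a" by (auto simp: fun_eq_iff)
  have "a \<in> X - {0}"
  proof (rule ccontr)
    assume "a \<notin> X - {0}"
    from permutes_not_in[OF permutes[OF q(1)] this] a show False by simp
  qed
  with q a that show thesis by blast
qed

text \<open>
  The vertices \<open>v i = 0\<^sup>i a\<close> with a letter \<open>a \<noteq> 0\<close> are pairwise incomparable and there are infinitely
  many of them.  Pairs of cosets are compared to get the same three vertices for \<open>p\<close> and for \<open>q\<close>;
  with only two vertices the commutator would keep a second factor, at the other vertex.
\<close>

lemma finite_index_above_finitary:
  assumes H: "subgroup H (tree_group X (eventually_directed X Q))"
    and F: "eventually_directed X {id} \<subseteq> H"
    and fin: "finite_index H (tree_group X (eventually_directed X Q))"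
  shows "H = eventually_directed X Q"
proof -
  define G where "G = eventually_directed X Q"
  let ?T = "tree_group X G"
  have G: "subgroup G (Aut_tree X)" unfolding G_def by (rule subgroup_eventually_directed)
  interpret A: group "Aut_tree X" by (rule group_Aut_tree)
  interpret T: group ?T unfolding tree_group_def by (rule subgroup.subgroup_is_group[OF G group_Aut_tree])
  have carT: "carrier ?T = G" by (simp add: tree_group_def)
  have multT: "g \<otimes>\<^bsub>?T\<^esub> h = g \<otimes>\<^bsub>Aut_tree X\<^esub> h" for g h by (simp add: tree_group_def)
  have invT: "inv\<^bsub>?T\<^esub> g = inv\<^bsub>Aut_tree X\<^esub> g" if "g \<in> G" for g
    using that unfolding tree_group_def by (rule A.m_inv_consistent[OF G])
  have HT: "subgroup H ?T" using H by (simp add: G_def)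
  have HA: "subgroup H (Aut_tree X)" and HG: "H \<subseteq> G"
    using HT subgroup_tree_group_iff[OF G] by blast+
  obtain a where a: "a \<in> X" "a \<noteq> 0" using moved_letter by blast
  define v where "v i = replicate i 0 @ [a]" for i :: nat
  have v: "v i \<in> lists X" for i using a zero_letter by (auto simp: v_def)
  have "\<not> prefix (v i) (v j)" if "i < j" for i j
  proof
    assume "prefix (v i) (v j)"
    then obtain z where "replicate i 0 @ [a] @ z = replicate j 0 @ [a]" by (auto simp: v_def prefix_def)
    then have "(replicate i 0 @ [a] @ z) ! i = (replicate j 0 @ [a]) ! i" by simp
    then show False using that a(2) by (simp add: nth_append)
  qed
  moreover have "\<not> prefix (v j) (v i)" if "i < j" for i j
    using that prefix_length_le[of "v j" "v i"] by (auto simp: v_def)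
  ultimately have incomparable: "\<not> prefix (v i) (v j)" if "i \<noteq> j" for i j
    using that by (metis nat_neq_iff)
  have atA: "directed_at X (v i) q \<in> tree_auts X" if "q \<in> Q" for i q
    by (rule directed_at_tree_auts[OF v that])
  have atG: "directed_at X (v i) q \<in> G" if "q \<in> Q" for i q
    using directed_at_directed_beyond[OF v that] by (auto simp: G_def eventually_directed_def)
  define K where "K = {q \<in> Q. directed_at X [] q \<in> H}"
  have "Q \<subseteq> K"
  proof (rule perfect)
    show "id \<in> K" using id_mem directed_at_id subgroup.one_closed[OF HA] by (simp add: K_def)
    show "p \<circ> q \<in> K" if "p \<in> K" "q \<in> K" for p q
      using that comp_mem directed_at_comp[of "[]" p q] subgroup.m_closed[OF HA] by (simp add: K_def)
    show "inv' p \<in> K" if "p \<in> K" for p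
      using that inv_mem directed_at_inv[of "[]" p] subgroup.m_inv_closed[OF HA] by (simp add: K_def)
    fix p q assume p: "p \<in> Q" and q: "q \<in> Q"
    define c where "c i = (H #>\<^bsub>?T\<^esub> directed_at X (v i) p, H #>\<^bsub>?T\<^esub> directed_at X (v i) q)" for i
    have "range c \<subseteq> (rcosets\<^bsub>?T\<^esub> H) \<times> (rcosets\<^bsub>?T\<^esub> H)"
      using T.rcosetsI[OF subgroup.subset[OF HT]] atG[OF p] atG[OF q] by (auto simp: c_def carT)
    moreover have "finite ((rcosets\<^bsub>?T\<^esub> H) \<times> (rcosets\<^bsub>?T\<^esub> H))"
      using fin by (simp add: finite_index_def G_def)
    ultimately have "finite (range c)" by (rule finite_subset)
    then obtain i0 where inf: "infinite {i \<in> UNIV. c i = c i0}"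
      using pigeonhole_infinite[OF infinite_UNIV_nat] by blast
    then obtain S where "S \<subseteq> {i \<in> UNIV. c i = c i0}" "card S = 3"
      using infinite_arbitrarily_large by blast
    then obtain i j k where ijk: "i \<noteq> j" "i \<noteq> k" "j \<noteq> k" "c i = c j" "c i = c k"
      by (auto simp: card_3_iff)
    have quot: "directed_at X (v m) r \<otimes>\<^bsub>Aut_tree X\<^esub> directed_at X (v n) (inv' r) \<in> H"
      if r: "r \<in> Q" and eq: "H #>\<^bsub>?T\<^esub> directed_at X (v m) r = H #>\<^bsub>?T\<^esub> directed_at X (v n) r" for m n r
    proof -
      have "directed_at X (v m) r \<in> H #>\<^bsub>?T\<^esub> directed_at X (v n) r"
        using T.rcos_self[OF _ HT, of "directed_at X (v m) r"] atG[OF r] eq by (simp add: carT)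
      then have "directed_at X (v m) r \<otimes>\<^bsub>?T\<^esub> inv\<^bsub>?T\<^esub> directed_at X (v n) r \<in> H"
        using subgroup.rcos_module_imp[OF HT T.is_group] atG[OF r] by (simp add: carT)
      then show ?thesis
        using invT[OF atG[OF r]] directed_at_inv[OF v r] by (simp add: multT)
    qed
    let ?p = "directed_at X (v i) p" and ?q = "directed_at X (v i) q"
    have "?p \<otimes>\<^bsub>Aut_tree X\<^esub> ?q \<otimes>\<^bsub>Aut_tree X\<^esub> inv\<^bsub>Aut_tree X\<^esub> (?q \<otimes>\<^bsub>Aut_tree X\<^esub> ?p) \<in> H"
    proof (rule A.mem_subgroup_of_commuting_products[OF HA])
      show "?p \<otimes>\<^bsub>Aut_tree X\<^esub> directed_at X (v j) (inv' p) \<in> H"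
        using ijk(4) by (intro quot[OF p]) (simp add: c_def)
      show "?q \<otimes>\<^bsub>Aut_tree X\<^esub> directed_at X (v k) (inv' q) \<in> H"
        using ijk(5) by (intro quot[OF q]) (simp add: c_def)
    qed (use ijk p q inv_mem atA directed_at_commute[OF v v] incomparable in auto)
    moreover have "?p \<otimes>\<^bsub>Aut_tree X\<^esub> ?q \<otimes>\<^bsub>Aut_tree X\<^esub> inv\<^bsub>Aut_tree X\<^esub> (?q \<otimes>\<^bsub>Aut_tree X\<^esub> ?p)
        = directed_at X (v i) (p \<circ> q \<circ> inv' (q \<circ> p))"
      using directed_at_comp[OF v] directed_at_inv[OF v] comp_mem inv_mem p q by simp
    moreover have "inv' (q \<circ> p) = inv' p \<circ> inv' q"
      using o_inv_distrib permutes_bij[OF permutes] p q by blast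
    ultimately have "directed_at X (v i) (p \<circ> q \<circ> inv' p \<circ> inv' q) \<in> H" by (simp add: comp_assoc)
    moreover have "p \<circ> q \<circ> inv' p \<circ> inv' q \<in> Q" using p q inv_mem comp_mem by blast
    ultimately show "p \<circ> q \<circ> inv' p \<circ> inv' q \<in> K"
      using directed_at_root_mem[OF HA F _ v] by (simp add: K_def)
  qed
  then have "G \<subseteq> H"
    unfolding G_def by (intro eventually_directed_generated[OF HA F]) (auto simp: K_def)
  then show ?thesis using HG by (simp add: G_def)
qed

text \<open>
  Below any level \<open>n\<close>, the automorphism \<open>\<beta>\<^sub>q\<close> still moves \<open>0\<^sup>n a\<close> if \<open>q\<close> moves \<open>a\<close>.
\<close>

lemma directed_not_finitary:
  obtains q where "q \<in> Q" "directed_at X [] q \<notin> eventually_directed X {id}"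
proof -
  obtain q a where q: "q \<in> Q" "a \<in> X - {0}" "q a \<noteq> a" by (rule moved_letter)
  have "directed_at X [] q \<notin> directed_beyond X {id} n" for n
  proof
    let ?o = "replicate n (0::nat)"
    assume n: "directed_at X [] q \<in> directed_beyond X {id} n"
    have o: "?o \<in> level X n" using zero_letter by (auto simp: level_def)
    have "directed_at X [] q (?o @ [a]) = directed_at X [] q ?o @ [a]"
      using directed_beyondE[OF n o] q(2) by (metis Cons_in_lists_iff DiffD1 directed_id lists.Nil singletonD)
    moreover have "directed q (?o @ z) = ?o @ directed q z" for z by (induction n) auto
    from this[of "[]"] this[of "[a]"]
    have "directed_at X [] q (?o @ [a]) = ?o @ [q a]" "directed_at X [] q ?o = ?o"
      using q(2) level_lists[OF o] by (auto simp: directed_at_def)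
    ultimately show False using q(3) by simp
  qed
  then show thesis using that q(1) by (auto simp: eventually_directed_def)
qed

lemma not_in_MF: "\<not> in_MF (tree_group X (eventually_directed X Q))"
proof -
  let ?G = "eventually_directed X Q"
  let ?T = "tree_group X ?G"
  let ?F = "eventually_directed X {id}"
  let ?B = "directed_at X [] ` Q"
  note G = subgroup_eventually_directed
  interpret F: letter_perms X "{id}"
    using finite_letters zero_letter by unfold_locales (auto simp: permutes_id)
  have T: "group ?T" unfolding tree_group_def by (rule subgroup.subgroup_is_group[OF G group_Aut_tree])
  have carT: "carrier ?T = ?G" by (simp add: tree_group_def)
  have "\<exists>M. maximal_subgroup M ?T \<and> ?F \<subseteq> M"
  proof (rule maximal_subgroup_above[OF T, where B = ?B])
    show "subgroup ?F ?T"
      using F.subgroup_eventually_directed finitary_subset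
      unfolding subgroup_tree_group_iff[OF G] by (auto simp: eventually_directed_def)
    have "Q \<subseteq> {q. q permutes X - {0}}" using permutes by blast
    then have "finite Q"
      by (rule finite_subset) (simp add: finite_permutations finite_letters)
    then show "finite ?B" by simp
    obtain q where "q \<in> Q" "directed_at X [] q \<notin> ?F" by (rule directed_not_finitary)
    then show "\<not> ?B \<subseteq> ?F" by blast
    show "?B \<subseteq> carrier ?T"
    proof (rule image_subsetI)
      fix q assume "q \<in> Q"
      then have "directed_at X [] q \<in> directed_beyond X Q 0"
        using directed_at_directed_beyond[of "[]" q] by simp
      then have "directed_at X [] q \<in> ?G"
        unfolding eventually_directed_def by blast
      then show "directed_at X [] q \<in> carrier ?T" by (simp only: carT)
    qed
    fix H assume H: "subgroup H ?T" and F: "?F \<subseteq> H" and B: "?B \<subseteq> H"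
    have "?G \<subseteq> H"
    proof (rule eventually_directed_generated[OF _ F])
      show "subgroup H (Aut_tree X)" using H subgroup_tree_group_iff[OF G] by blast
    qed (use B in blast)
    then show "H = carrier ?T" using subgroup.subset[OF H] by (simp add: carT)
  qed
  then obtain M where M: "maximal_subgroup M ?T" "?F \<subseteq> M" by blast
  have "subgroup M ?T" "M \<noteq> ?G" using M(1) by (simp_all add: maximal_subgroup_def carT)
  then have "\<not> finite_index M ?T"
    using finite_index_above_finitary[of M] M(2) by blast
  then show ?thesis using M(1) unfolding in_MF_def by blast
qed

end

lemma perfect_letter_perms_alt_group:
  assumes "n \<ge> 5"
  shows "perfect_letter_perms {0..n} (carrier (alt_group n))"
proof -
  interpret A: group "alt_group n" by (rule alt_group_is_group)
  have letters: "{0..n} - {0} = {1..n}" by auto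
  show ?thesis
  proof unfold_locales
    show "finite {0..n}" "0 \<in> {0..n}" by simp_all
    show "id \<in> carrier (alt_group n)" using A.one_closed by (simp add: alt_group_one)
    show "p \<circ> q \<in> carrier (alt_group n)" if "p \<in> carrier (alt_group n)" "q \<in> carrier (alt_group n)" for p q
      using A.m_closed[OF that] by (simp add: alt_group_mult)
    show "inv' p \<in> carrier (alt_group n)" if "p \<in> carrier (alt_group n)" for p
      by (rule alt_group_inv_closed[OF that])
    show "p permutes {0..n} - {0}" if "p \<in> carrier (alt_group n)" for p
      using that by (simp add: letters alt_group_carrier)
    show "carrier (alt_group n) \<noteq> {id}"
    proof
      assume "carrier (alt_group n) = {id}"
      then have "fact n = (2::nat)" using alt_group_card_carrier[of n] assms by simp
      moreover have "fact 5 \<le> (fact n :: nat)" by (rule fact_mono_nat[OF assms])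
      ultimately show False by (simp add: fact_numeral)
    qed
    fix K
    assume K: "id \<in> K" "\<And>p q. p \<in> K \<Longrightarrow> q \<in> K \<Longrightarrow> p \<circ> q \<in> K" "\<And>p. p \<in> K \<Longrightarrow> inv' p \<in> K"
      and com: "\<And>p q. p \<in> carrier (alt_group n) \<Longrightarrow> q \<in> carrier (alt_group n) \<Longrightarrow>
        p \<circ> q \<circ> inv' p \<circ> inv' q \<in> K"
    let ?D = "derived_set (alt_group n) (carrier (alt_group n))"
    have DK: "?D \<subseteq> K" using com by (auto simp: alt_group_mult alt_group_inv_equality)
    have DQ: "?D \<subseteq> carrier (alt_group n)" by (rule A.derived_set_in_carrier) simp
    have "p \<in> K" if "p \<in> generate (alt_group n) ?D" for p
      using that
    proof induction
      case one
      show ?case unfolding alt_group_one by (rule K(1))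
    next
      case (incl h)
      then show ?case using DK by blast
    next
      case (inv h)
      then have "h \<in> K" "h \<in> carrier (alt_group n)" using DK DQ by blast+
      then show ?case using K(3) by (simp add: alt_group_inv_equality)
    next
      case (eng h1 h2)
      then show ?case using K(2) by (simp only: alt_group_mult)
    qed
    then show "carrier (alt_group n) \<subseteq> K"
      using derived_alt_group_const[OF assms] unfolding derived_def by blast
  qed
qed

theorem mainTheorem4:
  shows "\<exists>(A :: nat set) (G :: (nat list \<Rightarrow> nat list) set).
           branch_group A G \<and>
           periodic_group (tree_group A G) \<and>
           \<not> in_MF (tree_group A G)"
proof -
  interpret perfect_letter_perms "{0..5}" "carrier (alt_group 5)"
    by (rule perfect_letter_perms_alt_group) simp
  show ?thesis
    using branch_group_eventually_directed periodic_eventually_directed not_in_MF by blast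
qed

end
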